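(* Let $W=(W_t)_{t\ge0}$ be a standard Brownian motion and let $f:\mathbb{R}\to\mathbb{R}$. The following assertions are equivalent: (i) $f$ is a measurable solution of the quadratic functional equation $f(x+y)+f(x-y)=2f(x)+2f(y)$ for all $x,y\in\mathbb{R}$; (ii) $f$ is a measurable even function with $f(0)=0$ such that $f(W_t)$ is integrable for every $t\ge0$ and the process $N_t=f(W_t)-E f(W_t)$, $t\ge0$, is a right-continuous martingale; (iii) $f(x)=ax^2$ for all $x\in\mathbb{R}$, for some constant $a\in\mathbb{R}$.
   Context: $W$ is a standard Brownian motion on a complete probability space $(\Omega,\mathcal{F},P)$, and $(\mathcal{F}_t)_{t\ge0}$ is the filtration generated by $W$; "martingale" means martingale with respect to this filtration. *)

theory Defs
  imports "HOL-Probability.Probability"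
begin

definition standard_brownian_motion :: "'a measure \<Rightarrow> (real \<Rightarrow> 'a \<Rightarrow> real) \<Rightarrow> bool" where
  "standard_brownian_motion M W \<longleftrightarrow>
     prob_space M \<and>
     (\<forall>t\<ge>0. W t \<in> borel_measurable M) \<and>
     (\<forall>\<omega>\<in>space M. W 0 \<omega> = 0) \<and>
     (\<forall>\<omega>\<in>space M. continuous_on {0..} (\<lambda>t. W t \<omega>)) \<and>
     (\<forall>s t. 0 \<le> s \<longrightarrow> s < t \<longrightarrow>
        distributed M lborel (\<lambda>\<omega>. W t \<omega> - W s \<omega>) (normal_density 0 (sqrt (t - s)))) \<and>
     (\<forall>ts::real list. sorted ts \<longrightarrow> (\<forall>t\<in>set ts. 0 \<le> t) \<longrightarrow>
        prob_space.indep_vars M (\<lambda>_. borel)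
          (\<lambda>i \<omega>. W (ts ! Suc i) \<omega> - W (ts ! i) \<omega>) {..<length ts - 1})"

definition natural_filtration :: "'a measure \<Rightarrow> (real \<Rightarrow> 'a \<Rightarrow> real) \<Rightarrow> real \<Rightarrow> 'a measure" where
  "natural_filtration M W t =
     sigma (space M) (\<Union>s\<in>{0..t}. {W s -` A \<inter> space M | A. A \<in> sets borel})"

definition martingale :: "'a measure \<Rightarrow> (real \<Rightarrow> 'a measure) \<Rightarrow> (real \<Rightarrow> 'a \<Rightarrow> real) \<Rightarrow> bool" where
  "martingale M F X \<longleftrightarrow>
     (\<forall>t\<ge>0. integrable M (X t) \<and> X t \<in> borel_measurable (F t)) \<and>
     (\<forall>s t. 0 \<le> s \<longrightarrow> s \<le> t \<longrightarrow>
        (AE \<omega> in M. real_cond_exp M (F s) (X t) \<omega> = X s \<omega>))"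

definition right_continuous_process :: "'a measure \<Rightarrow> (real \<Rightarrow> 'a \<Rightarrow> real) \<Rightarrow> bool" where
  "right_continuous_process M X \<longleftrightarrow>
     (\<forall>\<omega>\<in>space M. \<forall>t\<ge>0. continuous (at_right t) (\<lambda>s. X s \<omega>))"

end

theory Submission
  imports Defs
begin

text \<open>
  If \<open>N\<close> is a martingale, then conditioning \<open>f (W\<^bsub>1+h\<^esub>)\<close> on the past of time 1 shows that for
  every \<open>h > 0\<close> the Gaussian mean of variance \<open>h\<close> of \<open>f\<close> around \<open>x\<close> equals \<open>f x + c\<^sub>h\<close> for almost
  every \<open>x\<close>. As Gaussian means are continuous, \<open>f\<close> has a continuous version \<open>v\<close> for which this holds
  everywhere. For fixed \<open>x\<close>, the even function
  \<open>q r = v (x + r) + v (x - r) - 2 v r - 2 v x + 2 v 0\<close> then has vanishing centered Gaussian means of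
  all variances, so \<open>q = 0\<close> by Laplace uniqueness; that is, \<open>v - v 0\<close> solves the quadratic equation,
  which for measurable functions reduces to the Cauchy equation through the biadditive form
  \<open>f (x + y) - f (x - y)\<close>. Right-continuity removes the exceptional null set: almost surely \<open>W\<close>
  avoids it at all positive rational times, and every real is hit by a path at a positive time.
  The value at \<open>0\<close> fixes the remaining constant.
\<close>

section \<open>Measurable solutions of the quadratic functional equation\<close>

lemma additive_of_nat_mult:
  fixes h :: "real \<Rightarrow> real"
  assumes add: "\<And>x y. h (x + y) = h x + h y"
  shows "h (real n * x) = real n * h x"
proof (induction n)
  case 0
  then show ?case using add[of 0 0] by simp
next
  case (Suc n)
  then show ?case using add[of x "real n * x"] by (simp add: algebra_simps)
qed

lemma additive_Rats:
  fixes h :: "real \<Rightarrow> real"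
  assumes add: "\<And>x y. h (x + y) = h x + h y" and q: "q \<in> \<rat>"
  shows "h q = q * h 1"
proof -
  have h0: "h 0 = 0" using add[of 0 0] by simp
  have neg: "h (- x) = - h x" for x using add[of x "- x"] h0 by simp
  have pos: "h q = q * h 1" if q: "q \<in> \<rat>" "q \<ge> 0" for q
  proof -
    obtain m n :: nat where n: "n \<noteq> 0" and "\<bar>q\<bar> = real m / real n"
      using Rats_abs_nat_div_natE[OF q(1)] by metis
    with q have m: "q = real m / real n" by simp
    have "real n * h q = h (real n * q)" by (simp add: additive_of_nat_mult[OF add])
    also have "\<dots> = h (real m * 1)" using m n by simp
    also have "\<dots> = real m * h 1" by (rule additive_of_nat_mult[of h, OF add])
    also have "\<dots> = real n * (q * h 1)" using m n by simp
    finally show ?thesis using n by simp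
  qed
  show ?thesis
  proof (cases "q \<ge> 0")
    case True
    with q show ?thesis by (intro pos)
  next
    case False
    then have "h (- q) = - q * h 1" using q by (intro pos) auto
    then show ?thesis using neg[of q] by simp
  qed
qed

text \<open>This is a Steinhaus argument. The sets \<open>A n\<close>, on which
  \<open>\<bar>h\<bar> \<le> n\<close>, exhaust the unit interval, so one of them has measure above
  3/4. It must meet each of its translates by at most 1/4, which writes any small \<open>d\<close>
  as a difference of two points where \<open>h\<close> is bounded by \<open>n\<close>.\<close>

lemma additive_measurable_locally_bounded:
  fixes h :: "real \<Rightarrow> real"
  assumes add: "\<And>x y. h (x + y) = h x + h y" and [measurable]: "h \<in> borel_measurable borel"
  shows "\<exists>K. \<forall>x. \<bar>x\<bar> \<le> 1/4 \<longrightarrow> \<bar>h x\<bar> \<le> K"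
proof -
  define A where "A n = {x \<in> {0..1}. \<bar>h x\<bar> \<le> real n}" for n
  have Am [measurable]: "A n \<in> sets lborel" for n unfolding A_def by measurable
  have "(\<lambda>n. measure lborel (A n)) \<longlonglongrightarrow> measure lborel (\<Union>n. A n)"
  proof (rule Lim_measure_incseq)
    show "incseq A" unfolding A_def incseq_def by fastforce
    have "(\<Union>n. A n) \<subseteq> {0..1}" by (auto simp: A_def)
    then have "emeasure lborel (\<Union>n. A n) \<le> emeasure lborel {0..1::real}"
      by (intro emeasure_mono) auto
    then show "emeasure lborel (\<Union>n. A n) \<noteq> \<infinity>" by (auto simp: top_unique)
  qed (use Am in auto)
  moreover have "(\<Union>n. A n) = {0..1}"
    using real_arch_simple by (fastforce simp: A_def)
  ultimately have "(\<lambda>n. measure lborel (A n)) \<longlonglongrightarrow> 1" by simp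
  then have "\<forall>\<^sub>F n in sequentially. measure lborel (A n) > 3/4"
    by (rule order_tendstoD) simp
  then obtain n where n: "measure lborel (A n) > 3/4"
    by (auto simp: eventually_sequentially)
  have "\<bar>h d\<bar> \<le> 2 * real n" if d: "\<bar>d\<bar> \<le> 1/4" for d
  proof -
    define A' where "A' = (\<lambda>x. d + x) -` A n"
    have Am' [measurable]: "A' \<in> sets lborel"
      unfolding A'_def using measurable_sets[of "\<lambda>x. d + x" lborel borel "A n"] Am[of n] by simp
    have A'm: "measure lborel A' = measure lborel (A n)"
    proof -
      have "emeasure lborel (A n) = emeasure (distr lborel borel ((+) d)) (A n)"
        by (simp add: lborel_distr_plus)
      also have "\<dots> = emeasure lborel A'"
        using Am[of n] by (subst emeasure_distr) (auto simp: A'_def)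
      finally show ?thesis by (simp add: measure_def)
    qed
    have "A n \<inter> A' \<noteq> {}"
    proof
      assume e: "A n \<inter> A' = {}"
      \<comment> \<open>The enclosing interval has length 3/2, whereas two disjoint sets of measure
        above 3/4 would need more. This is where the thresholds 3/4 and 1/4 come from.\<close>
      have sub: "A n \<union> A' \<subseteq> {-1/4..5/4}" using d by (auto simp: A_def A'_def)
      have fin: "B \<in> fmeasurable lborel" if "B \<in> sets lborel" "B \<subseteq> {-1/4..5/4::real}" for B
        by (rule fmeasurableI2[OF _ that(2,1)]) (auto simp: fmeasurable_def)
      have "measure lborel (A n) + measure lborel A' = measure lborel (A n \<union> A')"
        using measure_Un2[of "A n" lborel A'] fin[of "A n"] fin[of A'] sub Am Am' e
        by (simp add: Diff_triv Int_commute)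
      also have "\<dots> \<le> measure lborel {-1/4..5/4::real}"
        using sub Am[of n] Am' by (intro measure_mono_fmeasurable fin sets.Un) auto
      finally show False using n A'm by simp
    qed
    then obtain x where x: "x \<in> A n" "d + x \<in> A n" by (auto simp: A'_def)
    have "h d = h (d + x) - h x" using add[of d x] by simp
    then show ?thesis using x by (auto simp: A_def)
  qed
  then show ?thesis by blast
qed

text \<open>After subtraction of \<open>x * h 1\<close> the additive remainder \<open>k\<close>
  vanishes on the rationals, hence has rational periods, and its bound near 0 becomes a global one.
  A bounded additive function is zero, because \<open>k (n * x) = n * k x\<close>.\<close>

lemma additive_measurable_linear:
  fixes h :: "real \<Rightarrow> real"
  assumes add: "\<And>x y. h (x + y) = h x + h y" and meas: "h \<in> borel_measurable borel"
  shows "h x = x * h 1"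
proof -
  define k where "k x = h x - x * h 1" for x
  have k_add: "k (x + y) = k x + k y" for x y by (simp add: k_def add algebra_simps)
  have "k \<in> borel_measurable borel" unfolding k_def using meas by measurable
  from additive_measurable_locally_bounded[OF k_add this]
  obtain K where K: "\<And>x. \<bar>x\<bar> \<le> 1/4 \<Longrightarrow> \<bar>k x\<bar> \<le> K" by blast
  have bound: "\<bar>k x\<bar> \<le> K" for x
  proof -
    obtain q where q: "q \<in> \<rat>" "x - 1/4 < q" "q < x" using Rats_dense_in_real[of "x - 1/4" x] by auto
    have "k q = 0" using additive_Rats[OF add q(1)] by (simp add: k_def)
    then have "k x = k (x - q)" using k_add[of "x - q" q] by simp
    then show ?thesis using K[of "x - q"] q by simp
  qed
  have "k x = 0"
  proof (rule ccontr)
    assume nz: "k x \<noteq> 0"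
    obtain n where "real n * \<bar>k x\<bar> > K" using nz reals_Archimedean3[of "\<bar>k x\<bar>"] by auto
    moreover have "real n * \<bar>k x\<bar> = \<bar>k (real n * x)\<bar>"
      by (simp add: additive_of_nat_mult[OF k_add] abs_mult)
    ultimately show False using bound[of "real n * x"] by simp
  qed
  then show ?thesis by (simp add: k_def)
qed

text \<open>Polarization: the form \<open>B\<close> is symmetric and additive in its first argument,
  so the measurable Cauchy equation, applied in each argument, gives
  \<open>B x y = x * y * B 1 1\<close>. The diagonal recovers the function through
  \<open>B z z = 4 * f z\<close>.\<close>

lemma quadratic_equation_measurable:
  fixes f :: "real \<Rightarrow> real"
  assumes [measurable]: "f \<in> borel_measurable borel"
    and eq: "\<And>x y. f (x + y) + f (x - y) = 2 * f x + 2 * f y"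
  shows "f x = f 1 * x\<^sup>2"
proof -
  define B where "B x y = f (x + y) - f (x - y)" for x y
  have f0: "f 0 = 0" using eq[of 0 0] by simp
  have even: "f (- y) = f y" for y using eq[of 0 y] f0 by simp
  have sym: "B x y = B y x" for x y
    unfolding B_def using even[of "x - y"] by (simp add: add.commute)
  have "B (x + z) y = B x y + B z y" for x y z
  proof -
    \<comment> \<open>The first equation minus the second has right-hand side
      \<open>2 * B x y\<close>, and the third minus the fourth has \<open>2 * B z y\<close>. Each
      left-hand side contains \<open>B (x + z) y\<close>. By evenness the remaining terms are
      opposite, so adding the two differences gives twice the claim.\<close>
    have "f (x + z + y) + f (x + y - z) = 2 * f (x + y) + 2 * f z"
      "f (x + z - y) + f (x - y - z) = 2 * f (x - y) + 2 * f z"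
      "f (z + y + x) + f (z + y - x) = 2 * f (z + y) + 2 * f x"
      "f (z - y + x) + f (z - y - x) = 2 * f (z - y) + 2 * f x"
      using eq[of "x + y" z] eq[of "x - y" z] eq[of "z + y" x] eq[of "z - y" x]
      by (simp_all add: algebra_simps)
    moreover have "f (z + y - x) = f (x - y - z)" "f (z - y - x) = f (x + y - z)"
      using even[of "z + y - x"] even[of "z - y - x"] by (simp_all add: algebra_simps)
    moreover have "z + y + x = x + z + y" "z - y + x = x + z - y" by simp_all
    ultimately show ?thesis unfolding B_def by (simp only:)
  qed
  moreover have "(\<lambda>x. B x y) \<in> borel_measurable borel" for y
    unfolding B_def by measurable
  ultimately have lin: "B x y = x * B 1 y" for x y
    using additive_measurable_linear[of "\<lambda>x. B x y"] by blast
  have "B x x = x * B 1 x" by (rule lin)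
  also have "B 1 x = x * B 1 1" using lin[of x 1] sym by simp
  finally have "B x x = x * (x * B 1 1)" .
  moreover have "B z z = 4 * f z" for z
    unfolding B_def using eq[of z z] f0 by simp
  ultimately show ?thesis by (simp add: power2_eq_square)
qed

section \<open>Functions with invariant Gaussian means\<close>

text \<open>This is integrability under all centered normal laws, with
  \<open>b = 1 / (2 * t)\<close> for variance \<open>t\<close>. Requiring every \<open>b > 0\<close>
  makes the class invariant under translations, since a shift of the kernel can be absorbed by
  halving \<open>b\<close>.\<close>

definition gaussian_integrable :: "(real \<Rightarrow> real) \<Rightarrow> bool" where
  "gaussian_integrable f \<longleftrightarrow> f \<in> borel_measurable borel \<and>
     (\<forall>b>0. integrable lborel (\<lambda>y. f y * exp (- (b * y\<^sup>2))))"

text \<open>The kernel is left unnormalized: the factor \<open>sqrt (b / pi)\<close> is omitted, so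
  a constant is multiplied by the total mass of the kernel.\<close>

definition gaussian_mean :: "real \<Rightarrow> (real \<Rightarrow> real) \<Rightarrow> real \<Rightarrow> real" where
  "gaussian_mean b f x = (\<integral>y. f (x + y) * exp (- (b * y\<^sup>2)) \<partial>lborel)"

lemma gaussian_integrable_measurable:
  "gaussian_integrable f \<Longrightarrow> f \<in> borel_measurable borel"
  by (simp add: gaussian_integrable_def)

lemma gaussian_integrableD:
  "gaussian_integrable f \<Longrightarrow> b > 0 \<Longrightarrow> integrable lborel (\<lambda>y. f y * exp (- (b * y\<^sup>2)))"
  by (simp add: gaussian_integrable_def)

text \<open>From \<open>(y - x)\<^sup>2 \<ge> y\<^sup>2 / 2 - x\<^sup>2\<close>. The bound is
  uniform over \<open>\<bar>x\<bar> \<le> R\<close>, which supplies a single dominating function for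
  all bounded translations.\<close>

lemma shifted_gaussian_le:
  fixes b x y R :: real
  assumes "b > 0" "\<bar>x\<bar> \<le> R"
  shows "exp (- (b * (y - x)\<^sup>2)) \<le> exp (b * R\<^sup>2) * exp (- (b / 2 * y\<^sup>2))"
proof -
  have "x\<^sup>2 \<le> R\<^sup>2" using assms(2) by (metis abs_ge_zero power2_abs power_mono)
  moreover have "(y - x)\<^sup>2 - y\<^sup>2 / 2 + x\<^sup>2 = (y - 2 * x)\<^sup>2 / 2"
    by (simp add: power2_eq_square field_simps)
  ultimately have "y\<^sup>2 / 2 - R\<^sup>2 \<le> (y - x)\<^sup>2"
    using zero_le_power2[of "y - 2 * x"] by linarith
  then have "b * (y\<^sup>2 / 2 - R\<^sup>2) \<le> b * (y - x)\<^sup>2"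
    using assms(1) by (intro mult_left_mono) auto
  then have "- (b * (y - x)\<^sup>2) \<le> b * R\<^sup>2 + - (b / 2 * y\<^sup>2)"
    by (simp add: algebra_simps)
  then show ?thesis by (simp only: exp_add[symmetric] exp_le_cancel_iff)
qed

lemma gaussian_integrable_centered:
  assumes f: "gaussian_integrable f" and b: "b > 0"
  shows "integrable lborel (\<lambda>z. f z * exp (- (b * (z - x)\<^sup>2)))"
proof (rule Bochner_Integration.integrable_bound)
  have [measurable]: "f \<in> borel_measurable borel" by (rule gaussian_integrable_measurable[OF f])
  show "integrable lborel (\<lambda>z. exp (b * \<bar>x\<bar>\<^sup>2) * (f z * exp (- (b / 2 * z\<^sup>2))))"
    using gaussian_integrableD[OF f, of "b / 2"] b by simp
  show "AE z in lborel. norm (f z * exp (- (b * (z - x)\<^sup>2)))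
      \<le> norm (exp (b * \<bar>x\<bar>\<^sup>2) * (f z * exp (- (b / 2 * z\<^sup>2))))"
  proof (rule AE_I2)
    fix z
    have "\<bar>f z\<bar> * exp (- (b * (z - x)\<^sup>2)) \<le> \<bar>f z\<bar> * (exp (b * \<bar>x\<bar>\<^sup>2) * exp (- (b / 2 * z\<^sup>2)))"
      using shifted_gaussian_le[OF b order_refl[of "\<bar>x\<bar>"], of z]
      by (intro mult_left_mono) auto
    then show "norm (f z * exp (- (b * (z - x)\<^sup>2)))
      \<le> norm (exp (b * \<bar>x\<bar>\<^sup>2) * (f z * exp (- (b / 2 * z\<^sup>2))))"
      by (simp add: abs_mult mult_ac)
  qed
qed (use gaussian_integrable_measurable[OF f] in measurable)

lemma gaussian_integrable_shift:
  assumes f: "gaussian_integrable f"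
  shows "gaussian_integrable (\<lambda>y. f (x + y))"
  unfolding gaussian_integrable_def
proof (intro conjI allI impI)
  show "(\<lambda>y. f (x + y)) \<in> borel_measurable borel" using gaussian_integrable_measurable[OF f] by measurable
  fix b :: real assume b: "b > 0"
  show "integrable lborel (\<lambda>y. f (x + y) * exp (- (b * y\<^sup>2)))"
    using lborel_integrable_real_affine[OF gaussian_integrable_centered[OF f b, of x], of 1 x]
    by simp
qed

lemma normal_density_precision:
  assumes "b > 0"
  shows "normal_density 0 (sqrt (1 / (2 * b))) y = sqrt (b / pi) * exp (- (b * y\<^sup>2))"
proof -
  have sq: "(sqrt (1 / (2 * b)))\<^sup>2 = 1 / (2 * b)" using assms by simp
  show ?thesis unfolding normal_density_def sq using assms by (simp add: real_sqrt_divide mult.commute)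
qed

lemma gaussian_integral:
  assumes "b > 0"
  shows "(\<integral>y. exp (- (b * y\<^sup>2)) \<partial>lborel) * sqrt (b / pi) = 1"
    and "integrable lborel (\<lambda>y. exp (- (b * y\<^sup>2)))"
proof -
  have s: "sqrt (b / pi) > 0" using assms by simp
  have n: "(\<lambda>y. exp (- (b * y\<^sup>2))) = (\<lambda>y. normal_density 0 (sqrt (1 / (2 * b))) y / sqrt (b / pi))"
    using s assms by (simp add: normal_density_precision[OF assms])
  have pos: "0 < sqrt (1 / (2 * b))" using assms by simp
  show "integrable lborel (\<lambda>y. exp (- (b * y\<^sup>2)))"
    unfolding n by (intro integrable_divide integrable_normal_density pos)
  show "(\<integral>y. exp (- (b * y\<^sup>2)) \<partial>lborel) * sqrt (b / pi) = 1"
    unfolding n integral_divide_zero integral_normal_density[OF pos] using s assms by simp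
qed

lemma gaussian_mean_eq_centered:
  "gaussian_mean b f x = (\<integral>z. f z * exp (- (b * (z - x)\<^sup>2)) \<partial>lborel)"
  unfolding gaussian_mean_def
  by (subst (2) lborel_integral_real_affine[where c=1 and t=x]) simp_all

text \<open>Once the translation is moved from \<open>f\<close> to the kernel, only the smooth
  kernel depends on \<open>x\<close>, so dominated convergence applies although \<open>f\<close> is
  merely measurable. A convergent sequence stays in some \<open>[-R, R]\<close>, which fixes the
  dominating function.\<close>

lemma gaussian_mean_continuous:
  assumes f: "gaussian_integrable f" and b: "b > 0"
  shows "continuous_on UNIV (gaussian_mean b f)"
  unfolding continuous_on_sequentially
proof (intro allI ballI impI)
  have [measurable]: "f \<in> borel_measurable borel" by (rule gaussian_integrable_measurable[OF f])
  fix X x assume "(\<forall>n. X n \<in> UNIV) \<and> X \<longlonglongrightarrow> (x::real)"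
  then have X: "X \<longlonglongrightarrow> x" by simp
  then obtain R where R: "\<And>n. \<bar>X n\<bar> \<le> R"
    using convergent_imp_Bseq[of X] unfolding convergent_def Bseq_def by auto
  have "(\<lambda>n. \<integral>z. f z * exp (- (b * (z - X n)\<^sup>2)) \<partial>lborel)
      \<longlonglongrightarrow> (\<integral>z. f z * exp (- (b * (z - x)\<^sup>2)) \<partial>lborel)"
  proof (rule integral_dominated_convergence)
    show "integrable lborel (\<lambda>z. \<bar>exp (b * R\<^sup>2) * (f z * exp (- (b / 2 * z\<^sup>2)))\<bar>)"
      using gaussian_integrableD[OF f, of "b / 2"] b by (intro integrable_abs) simp
    show "AE z in lborel. (\<lambda>n. f z * exp (- (b * (z - X n)\<^sup>2))) \<longlonglongrightarrow> f z * exp (- (b * (z - x)\<^sup>2))"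
      by (intro AE_I2 tendsto_intros X)
    fix n
    show "AE z in lborel. norm (f z * exp (- (b * (z - X n)\<^sup>2)))
        \<le> \<bar>exp (b * R\<^sup>2) * (f z * exp (- (b / 2 * z\<^sup>2)))\<bar>"
    proof (rule AE_I2)
      fix z
      have "\<bar>f z\<bar> * exp (- (b * (z - X n)\<^sup>2)) \<le> \<bar>f z\<bar> * (exp (b * R\<^sup>2) * exp (- (b / 2 * z\<^sup>2)))"
        using shifted_gaussian_le[OF b R[of n], of z] by (intro mult_left_mono) auto
      then show "norm (f z * exp (- (b * (z - X n)\<^sup>2)))
          \<le> \<bar>exp (b * R\<^sup>2) * (f z * exp (- (b / 2 * z\<^sup>2)))\<bar>"
        by (simp add: abs_mult mult_ac)
    qed
  qed measurable
  then show "(gaussian_mean b f \<circ> X) \<longlonglongrightarrow> gaussian_mean b f x"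
    by (simp add: gaussian_mean_eq_centered comp_def)
qed

text \<open>The coincidence set is closed, and a closed set of full Lebesgue measure is the whole
  line.\<close>

lemma continuous_AE_eq_imp_eq:
  fixes f g :: "real \<Rightarrow> real"
  assumes "continuous_on UNIV f" "continuous_on UNIV g" "AE x in lborel. f x = g x"
  shows "f x = g x"
proof -
  have "closed {x. f x = g x}" by (rule closed_Collect_eq) (use assms in auto)
  moreover have "AE x in lebesgue. x \<in> {x. f x = g x}"
    using assms(3) by (simp add: AE_completion)
  ultimately show ?thesis using mem_closed_if_AE_lebesgue[of "{x. f x = g x}"] by blast
qed

text \<open>By Weierstrass, the functions
  \<open>\<psi>(exp (-y\<^sup>2))\<close> with \<open>\<psi>\<close> continuous on \<open>[0,1]\<close> are uniform limits of polynomials in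
  \<open>exp (-y\<^sup>2)\<close>, and \<open>exp (-y\<^sup>2) q y / (1 + |q y|)\<close> is such a function.\<close>

lemma even_gaussian_moments_zero:
  fixes q :: "real \<Rightarrow> real"
  assumes cont: "continuous_on UNIV q" and even: "\<And>y. q (- y) = q y"
    and int: "gaussian_integrable q"
    and zero: "\<And>n::nat. n \<ge> 1 \<Longrightarrow> (\<integral>y. q y * exp (- (real n * y\<^sup>2)) \<partial>lborel) = 0"
  shows "q x = 0"
proof -
  define e where "e y = exp (- (1 * y\<^sup>2))" for y :: real
  have qi: "integrable lborel (\<lambda>y. q y * e y)"
    unfolding e_def by (rule gaussian_integrableD[OF int]) simp
  have [measurable]: "q \<in> borel_measurable borel" by (rule gaussian_integrable_measurable[OF int])
  have [measurable]: "e \<in> borel_measurable borel" unfolding e_def by measurable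
  have e01: "0 < e y" "e y \<le> 1" for y by (auto simp: e_def)
  \<comment> \<open>\<open>sqrt (- ln w)\<close> inverts \<open>e\<close> on the nonnegative
    half-line, and evenness of \<open>q\<close> covers the other half. The denominator keeps
    \<open>\<bar>\<psi> w\<bar> \<le> \<bar>w\<bar>\<close>, so \<open>\<psi>\<close> is continuous
    at 0 however fast \<open>q\<close> grows.\<close>
  define \<psi> where "\<psi> w = (if w = 0 then 0 else w * q (sqrt (- ln w)) / (1 + \<bar>q (sqrt (- ln w))\<bar>))" for w
  have \<psi>_le: "\<bar>\<psi> w\<bar> \<le> \<bar>w\<bar>" for w
  proof -
    have "\<bar>w\<bar> * \<bar>z\<bar> / (1 + \<bar>z\<bar>) \<le> \<bar>w\<bar>" for z :: real
      by (simp add: divide_le_eq algebra_simps add_pos_nonneg)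
    then show ?thesis by (auto simp: \<psi>_def abs_mult)
  qed
  have \<psi>_e: "\<psi> (e y) = e y * q y / (1 + \<bar>q y\<bar>)" for y
  proof -
    have "q \<bar>y\<bar> = q y" using even[of y] by (cases "y \<ge> 0") auto
    moreover have "sqrt (- ln (e y)) = \<bar>y\<bar>" by (simp add: e_def)
    ultimately show ?thesis using e01(1)[of y] by (simp add: \<psi>_def)
  qed
  have \<psi>_cont: "continuous_on {0..1} \<psi>"
    unfolding continuous_on_eq_continuous_within
  proof
    fix w :: real assume w: "w \<in> {0..1}"
    show "continuous (at w within {0..1}) \<psi>"
    proof (cases "w = 0")
      case True
      have "(\<psi> \<longlongrightarrow> 0) (at 0 within {0..1})"
      proof (rule Lim_null_comparison)
        show "\<forall>\<^sub>F w in at 0 within {0..1}. norm (\<psi> w) \<le> \<bar>w\<bar>" using \<psi>_le by simp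
        show "((\<lambda>w. \<bar>w\<bar>) \<longlongrightarrow> 0) (at 0 within {0..1::real})"
          by (rule tendsto_eq_intros refl)+ simp
      qed
      then show ?thesis using True by (simp add: continuous_within \<psi>_def)
    next
      case False
      with w have w0: "w > 0" by simp
      have "isCont q z" for z using cont by (simp add: continuous_on_eq_continuous_at)
      moreover have "isCont (\<lambda>w. sqrt (- ln w)) w"
        using w0 by (intro continuous_intros) auto
      ultimately have "isCont (\<lambda>w. q (sqrt (- ln w))) w"
        using isCont_o2[of w "\<lambda>w. sqrt (- ln w)" q] by blast
      moreover have "1 + \<bar>z\<bar> \<noteq> 0" for z :: real by linarith
      ultimately have "isCont (\<lambda>w. w * q (sqrt (- ln w)) / (1 + \<bar>q (sqrt (- ln w))\<bar>)) w"
        by (intro continuous_intros) auto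
      moreover have "\<forall>\<^sub>F v in nhds w. \<psi> v = v * q (sqrt (- ln v)) / (1 + \<bar>q (sqrt (- ln v))\<bar>)"
        using eventually_nhds_in_open[of "{0<..}" w] w0
        by (auto elim!: eventually_mono simp: \<psi>_def)
      ultimately have "isCont \<psi> w" by (simp add: isCont_cong)
      then show ?thesis by (rule continuous_at_imp_continuous_at_within)
    qed
  qed
  have mono: "integrable lborel (\<lambda>y. q y * e y * e y ^ i)"
    "(\<integral>y. q y * e y * e y ^ i \<partial>lborel) = 0" for i
  proof -
    \<comment> \<open>One factor \<open>e y\<close> is reserved as the integrable weight, so the
      monomial of degree \<open>i\<close> corresponds to the moment with index \<open>Suc i\<close>,
      and the index 0 never occurs.\<close>
    have *: "(\<lambda>y. q y * e y * e y ^ i) = (\<lambda>y. q y * exp (- (real (Suc i) * y\<^sup>2)))"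
      by (auto simp: e_def fun_eq_iff exp_of_nat_mult[symmetric] exp_add[symmetric] algebra_simps)
    show "integrable lborel (\<lambda>y. q y * e y * e y ^ i)"
      unfolding * by (rule gaussian_integrableD[OF int]) simp
    show "(\<integral>y. q y * e y * e y ^ i \<partial>lborel) = 0" unfolding * by (rule zero) simp
  qed
  have \<psi>i: "integrable lborel (\<lambda>y. q y * e y * \<psi> (e y))"
  proof (rule Bochner_Integration.integrable_bound[OF qi])
    show "(\<lambda>y. q y * e y * \<psi> (e y)) \<in> borel_measurable lborel" unfolding \<psi>_e by measurable
    have "\<bar>\<psi> (e y)\<bar> \<le> 1" for y using \<psi>_le[of "e y"] e01[of y] by auto
    then show "AE y in lborel. norm (q y * e y * \<psi> (e y)) \<le> norm (q y * e y)"
      by (auto simp: abs_mult intro!: mult_left_le)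
  qed
  have bound: "\<bar>\<integral>y. q y * e y * \<psi> (e y) \<partial>lborel\<bar> \<le> \<delta> * (\<integral>y. \<bar>q y * e y\<bar> \<partial>lborel)" if \<delta>: "\<delta> > 0" for \<delta>
  proof -
    obtain p where "real_polynomial_function p" and p: "\<And>w. w \<in> {0..1} \<Longrightarrow> \<bar>\<psi> w - p w\<bar> < \<delta>"
      using Stone_Weierstrass_real_polynomial_function[OF compact_Icc \<psi>_cont \<delta>] by blast
    then obtain a n where pa: "p = (\<lambda>w. \<Sum>i\<le>n. a i * w ^ i)"
      unfolding real_polynomial_function_iff_sum by blast
    have sum: "(\<lambda>y. q y * e y * p (e y)) = (\<lambda>y. \<Sum>i\<le>n. a i * (q y * e y * e y ^ i))"
      by (simp add: pa sum_distrib_left mult_ac)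
    have pi: "integrable lborel (\<lambda>y. q y * e y * p (e y))" unfolding sum using mono(1) by simp
    have p0: "(\<integral>y. q y * e y * p (e y) \<partial>lborel) = 0"
      unfolding sum using mono by (subst Bochner_Integration.integral_sum) auto
    \<comment> \<open>The polynomial approximation can be subtracted freely because its integral
      against \<open>q * e\<close> is a combination of vanishing moments.\<close>
    have eq: "(\<integral>y. q y * e y * \<psi> (e y) \<partial>lborel) = (\<integral>y. q y * e y * \<psi> (e y) - q y * e y * p (e y) \<partial>lborel)"
      using \<psi>i pi p0 by simp
    have "\<bar>\<integral>y. q y * e y * \<psi> (e y) \<partial>lborel\<bar> \<le> (\<integral>y. \<bar>q y * e y * \<psi> (e y) - q y * e y * p (e y)\<bar> \<partial>lborel)"
      unfolding eq by (rule integral_abs_bound)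
    also have "\<dots> \<le> (\<integral>y. \<delta> * \<bar>q y * e y\<bar> \<partial>lborel)"
    proof (rule integral_mono)
      show "integrable lborel (\<lambda>y. \<bar>q y * e y * \<psi> (e y) - q y * e y * p (e y)\<bar>)"
        by (rule integrable_abs[OF Bochner_Integration.integrable_diff[OF \<psi>i pi]])
      show "integrable lborel (\<lambda>y. \<delta> * \<bar>q y * e y\<bar>)"
        by (rule integrable_mult_right[OF integrable_abs[OF qi]])
      fix y
      have "q y * e y * \<psi> (e y) - q y * e y * p (e y) = (q y * e y) * (\<psi> (e y) - p (e y))"
        by (rule right_diff_distrib[symmetric])
      moreover have "\<bar>\<psi> (e y) - p (e y)\<bar> \<le> \<delta>"
        by (intro less_imp_le p) (use e01[of y] in simp)
      then have "\<bar>q y * e y\<bar> * \<bar>\<psi> (e y) - p (e y)\<bar> \<le> \<bar>q y * e y\<bar> * \<delta>"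
        by (rule mult_left_mono) simp
      ultimately show "\<bar>q y * e y * \<psi> (e y) - q y * e y * p (e y)\<bar> \<le> \<delta> * \<bar>q y * e y\<bar>"
        by (simp only: abs_mult mult.commute[of \<delta>])
    qed
    finally show ?thesis by simp
  qed
  have "(\<integral>y. q y * e y * \<psi> (e y) \<partial>lborel) = 0"
  proof (rule ccontr)
    let ?I = "\<bar>\<integral>y. q y * e y * \<psi> (e y) \<partial>lborel\<bar>" and ?C = "\<integral>y. \<bar>q y * e y\<bar> \<partial>lborel"
    assume "(\<integral>y. q y * e y * \<psi> (e y) \<partial>lborel) \<noteq> 0"
    then have I: "?I > 0" by simp
    have C: "?C \<ge> 0" by simp
    \<comment> \<open>The choice of \<open>?I / (?C + 1)\<close> as the accuracy makes the bound
      strictly smaller than \<open>?I\<close>; the added 1 also covers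
      \<open>?C = 0\<close>.\<close>
    have "?I \<le> ?I / (?C + 1) * ?C" using I C by (intro bound divide_pos_pos) linarith+
    also have "\<dots> = ?I * (?C / (?C + 1))" by simp
    also have "\<dots> < ?I * 1" using C by (intro mult_strict_left_mono I, subst divide_less_eq_1_pos) linarith+
    finally show False by simp
  qed
  moreover have "AE y in lborel. 0 \<le> q y * e y * \<psi> (e y)"
  proof (rule AE_I2)
    fix y
    \<comment> \<open>The test function was built so that the integrand is a square over a positive
      number; a zero integral then forces \<open>q = 0\<close> almost everywhere.\<close>
    have "q y * e y * \<psi> (e y) = (e y * q y)\<^sup>2 / (1 + \<bar>q y\<bar>)"
      unfolding \<psi>_e by (simp add: power2_eq_square mult_ac)
    then show "0 \<le> q y * e y * \<psi> (e y)" by simp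
  qed
  ultimately have "AE y in lborel. q y * e y * \<psi> (e y) = 0"
    using integral_nonneg_eq_0_iff_AE[OF \<psi>i] by simp
  then have "AE y in lborel. q y = 0"
  proof eventually_elim
    case (elim y)
    then show ?case using e01(1)[of y] by (auto simp: \<psi>_e)
  qed
  then show ?thesis by (rule continuous_AE_eq_imp_eq[OF cont continuous_on_const])
qed

section \<open>From invariant Gaussian means to quadratic functions\<close>

lemma gaussian_mean_even:
  assumes "\<And>y. f (- y) = f y"
  shows "gaussian_mean b f (- x) = gaussian_mean b f x"
proof -
  have "f (- x + - y) = f (x + y)" for y
    using assms[of "x + y"] by simp
  then show ?thesis
    unfolding gaussian_mean_def
    by (subst lborel_integral_real_affine[where c="-1" and t=0]) simp_all
qed

lemma gaussian_mean_cong_AE: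
  assumes "gaussian_integrable f" "gaussian_integrable g" "AE x in lborel. f x = g x"
  shows "gaussian_mean b f x = gaussian_mean b g x"
proof -
  have [measurable]: "f \<in> borel_measurable borel" "g \<in> borel_measurable borel"
    using assms by (auto intro: gaussian_integrable_measurable)
  show ?thesis
    unfolding gaussian_mean_eq_centered
    by (rule integral_cong_AE) (use assms(3) in auto)
qed

lemma gaussian_mean_invariant_imp_quadratic:
  fixes f :: "real \<Rightarrow> real"
  assumes f: "gaussian_integrable f" and even: "\<And>x. f (- x) = f x"
    and inv: "\<And>b. b > 0 \<Longrightarrow> \<exists>c. AE x in lborel.
      gaussian_mean b f x = (\<integral>y. exp (- (b * y\<^sup>2)) \<partial>lborel) * f x + c"
  shows "\<exists>a k. AE x in lborel. f x = a * x\<^sup>2 + k"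
proof -
  define E where "E b y = exp (- (b * y\<^sup>2))" for b y :: real
  define Z where "Z b = (\<integral>y. E b y \<partial>lborel)" for b
  have Z1: "Z 1 \<noteq> 0" using gaussian_integral(1)[of 1] unfolding Z_def E_def by auto
  obtain c where c: "\<And>b. b > 0 \<Longrightarrow> AE x in lborel. gaussian_mean b f x = Z b * f x + c b"
    using inv unfolding Z_def E_def by metis
  \<comment> \<open>This solves the identity for \<open>b = 1\<close> for the value of the function,
    so \<open>v\<close> inherits continuity from the Gaussian mean.\<close>
  define v where "v x = (gaussian_mean 1 f x - c 1) / Z 1" for x
  have v_cont: "continuous_on UNIV v"
    unfolding v_def using Z1 gaussian_mean_continuous[OF f, of 1]
    by (intro continuous_intros) auto
  have v_even: "v (- x) = v x" for x
    unfolding v_def using gaussian_mean_even[of f, OF even] by simp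
  have [measurable]: "f \<in> borel_measurable borel" "v \<in> borel_measurable borel"
    using gaussian_integrable_measurable[OF f] borel_measurable_continuous_onI[OF v_cont] by auto
  have v_AE: "AE x in lborel. f x = v x"
    using c[of 1] Z1 by (auto simp: v_def field_simps)
  have v_gi: "gaussian_integrable v"
    unfolding gaussian_integrable_def
  proof (intro conjI allI impI)
    fix b :: real assume "b > 0"
    then show "integrable lborel (\<lambda>y. v y * exp (- (b * y\<^sup>2)))"
      by (rule integrable_cong_AE_imp[OF gaussian_integrableD[OF f]]) (use v_AE in auto)
  qed measurable
  \<comment> \<open>Gaussian means do not see null sets, so \<open>v\<close> satisfies the same
    almost-everywhere identities as \<open>f\<close>; with both sides continuous they hold at every
    point.\<close>
  have v_inv: "gaussian_mean b v x = Z b * v x + c b" if b: "b > 0" for b x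
  proof (rule continuous_AE_eq_imp_eq[where f="gaussian_mean b v" and g="\<lambda>x. Z b * v x + c b"])
    show "continuous_on UNIV (gaussian_mean b v)" by (rule gaussian_mean_continuous[OF v_gi b])
    show "continuous_on UNIV (\<lambda>x. Z b * v x + c b)" by (intro continuous_intros v_cont)
    show "AE x in lborel. gaussian_mean b v x = Z b * v x + c b"
      using c[OF b] v_AE
    proof eventually_elim
      case (elim x)
      then show ?case using gaussian_mean_cong_AE[OF f v_gi v_AE, of b x] by simp
    qed
  qed
  \<comment> \<open>The subtracted constant \<open>2 * v x - 2 * v 0\<close> is the normalized
    Gaussian mean of the other three terms in \<open>r\<close>, as computed from
    \<open>v_inv\<close>.\<close>
  have quad: "v (x + r) + v (x - r) - 2 * v r - (2 * v x - 2 * v 0) = 0" for x r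
  proof (rule even_gaussian_moments_zero[where q = "\<lambda>r. v (x + r) + v (x - r) - 2 * v r - (2 * v x - 2 * v 0)"])
    define q where "q r = v (x + r) + v (x - r) - 2 * v r - (2 * v x - 2 * v 0)" for r
    have "isCont v z" for z using v_cont by (simp add: continuous_on_eq_continuous_at)
    then show "continuous_on UNIV (\<lambda>r. v (x + r) + v (x - r) - 2 * v r - (2 * v x - 2 * v 0))"
      by (intro continuous_intros continuous_on_compose2[OF v_cont]) auto
    show "v (x + - y) + v (x - - y) - 2 * v (- y) - (2 * v x - 2 * v 0) =
        v (x + y) + v (x - y) - 2 * v y - (2 * v x - 2 * v 0)" for y
      using v_even[of y] by simp
    \<comment> \<open>Evenness turns \<open>v (x - r)\<close> into \<open>v (- x + r)\<close>, so
      that each term is a translate and integrates to a Gaussian mean of \<open>v\<close>.\<close>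
    have q_eq: "q r * E b r = v (x + r) * E b r + v (- x + r) * E b r - 2 * (v (0 + r) * E b r)
        - (2 * v x - 2 * v 0) * E b r" for b r
      using v_even[of "x - r"] by (simp add: q_def algebra_simps)
    have vi: "integrable lborel (\<lambda>r. v (z + r) * E b r)" if "b > 0" for b z
      unfolding E_def by (rule gaussian_integrableD[OF gaussian_integrable_shift[OF v_gi] that])
    have Ei: "integrable lborel (E b)" if "b > 0" for b
      using gaussian_integral(2)[OF that] unfolding E_def .
    have qi: "integrable lborel (\<lambda>r. q r * E b r)" if "b > 0" for b
      unfolding q_eq
      by (intro Bochner_Integration.integrable_diff Bochner_Integration.integrable_add
          integrable_mult_right vi Ei that)
    have q_meas: "q \<in> borel_measurable borel" unfolding q_def by measurable
    have "gaussian_integrable q"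
      using qi q_meas unfolding gaussian_integrable_def E_def by blast
    then show "gaussian_integrable (\<lambda>r. v (x + r) + v (x - r) - 2 * v r - (2 * v x - 2 * v 0))"
      unfolding q_def .
    fix n :: nat assume "n \<ge> 1"
    then have n: "real n > 0" by simp
    \<comment> \<open>The unknown constant \<open>c n\<close> enters the three means with weights 1,
      1 and -2 and therefore cancels; \<open>v (- x) = v x\<close> removes the rest.\<close>
    have "(\<integral>r. q r * E n r \<partial>lborel) = gaussian_mean n v x + gaussian_mean n v (- x)
        - 2 * gaussian_mean n v 0 - (2 * v x - 2 * v 0) * Z n"
      unfolding q_eq Z_def gaussian_mean_def E_def[symmetric] using vi[OF n, of x] vi[OF n, of "- x"] vi[OF n, of 0] Ei[OF n] by simp
    also have "\<dots> = 0" using v_inv[OF n] v_even by (simp add: algebra_simps)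
    finally show "(\<integral>r. (v (x + r) + v (x - r) - 2 * v r - (2 * v x - 2 * v 0)) *
        exp (- (real n * r\<^sup>2)) \<partial>lborel) = 0"
      unfolding q_def E_def .
  qed
  have "v x - v 0 = (v 1 - v 0) * x\<^sup>2" for x
  proof (rule quadratic_equation_measurable[where f = "\<lambda>x. v x - v 0"])
    show "v (x + y) - v 0 + (v (x - y) - v 0) = 2 * (v x - v 0) + 2 * (v y - v 0)" for x y
      using quad[of x y] by (simp add: algebra_simps)
  qed measurable
  then have vq: "v x = (v 1 - v 0) * x\<^sup>2 + v 0" for x by (metis diff_add_cancel)
  have "AE x in lborel. f x = (v 1 - v 0) * x\<^sup>2 + v 0"
    using v_AE
  proof eventually_elim
    case (elim x)
    then show ?case using vq[of x] by simp
  qed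
  then show ?thesis by blast
qed

section \<open>Brownian motion\<close>

locale brownian_motion = prob_space M for M :: "'a measure" +
  fixes W :: "real \<Rightarrow> 'a \<Rightarrow> real"
  assumes bm: "standard_brownian_motion M W"
begin

lemma W_measurable: "t \<ge> 0 \<Longrightarrow> W t \<in> borel_measurable M"
  and W_zero: "\<omega> \<in> space M \<Longrightarrow> W 0 \<omega> = 0"
  and W_continuous: "\<omega> \<in> space M \<Longrightarrow> continuous_on {0..} (\<lambda>t. W t \<omega>)"
  and W_increment: "0 \<le> s \<Longrightarrow> s < t \<Longrightarrow>
    distributed M lborel (\<lambda>\<omega>. W t \<omega> - W s \<omega>) (normal_density 0 (sqrt (t - s)))"
  and W_indep_increments: "sorted ts \<Longrightarrow> \<forall>t\<in>set ts. 0 \<le> t \<Longrightarrow>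
    indep_vars (\<lambda>_. borel) (\<lambda>i \<omega>. W (ts ! Suc i) \<omega> - W (ts ! i) \<omega>) {..<length ts - 1}"
  using bm unfolding standard_brownian_motion_def by blast+

lemma W_distributed:
  assumes "t > 0"
  shows "distributed M lborel (W t) (normal_density 0 (sqrt t))"
proof -
  have eq: "W t \<omega> - W 0 \<omega> = W t \<omega>" if "\<omega> \<in> space M" for \<omega> using W_zero[OF that] by simp
  have "distr M lborel (\<lambda>\<omega>. W t \<omega> - W 0 \<omega>) = distr M lborel (W t)"
    by (rule distr_cong) (auto simp: eq)
  then show ?thesis
    using W_increment[of 0 t] assms W_measurable[of t] unfolding distributed_def by simp
qed

section \<open>The past of Brownian motion and its independence from later increments\<close>

lemma sets_natural_filtration:
  "sets (natural_filtration M W s) =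
    sigma_sets (space M) (\<Union>r\<in>{0..s}. {W r -` A \<inter> space M | A. A \<in> sets borel})"
  unfolding natural_filtration_def by (rule sets_measure_of) auto

lemma space_natural_filtration [simp]: "space (natural_filtration M W s) = space M"
  unfolding natural_filtration_def by (rule space_measure_of) auto

lemma W_natural_filtration:
  assumes "0 \<le> r" "r \<le> s"
  shows "W r \<in> borel_measurable (natural_filtration M W s)"
proof (rule measurableI)
  fix A :: "real set" assume "A \<in> sets borel"
  then show "W r -` A \<inter> space (natural_filtration M W s) \<in> sets (natural_filtration M W s)"
    unfolding sets_natural_filtration space_natural_filtration using assms
    by (intro sigma_sets.Basic UN_I[of r] CollectI exI[of _ A]) auto
qed simp

lemma subalgebra_natural_filtration: "subalgebra M (natural_filtration M W s)"
  unfolding subalgebra_def space_natural_filtration sets_natural_filtration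
  using measurable_sets[OF W_measurable] by (auto intro!: sets.sigma_sets_subset)

lemma finite_measure_subalgebra_natural_filtration:
  "finite_measure_subalgebra M (natural_filtration M W s)"
  by (intro finite_measure_subalgebra.intro finite_measure_subalgebra_axioms.intro
      finite_measure_axioms subalgebra_natural_filtration)

text \<open>Independence is assumed only for consecutive increments along a sorted list of times.
  Since \<open>W 0 = 0\<close>, the values at the times in \<open>T\<close> are partial sums of
  increments up to time \<open>s\<close>, and the increment from \<open>s\<close> to
  \<open>t\<close> is the next one in the list.\<close>

lemma indep_cylinder_increment:
  assumes st: "0 \<le> s" "s < t" and T: "finite T" "T \<subseteq> {0..s}"
    and A: "\<And>r. r \<in> T \<Longrightarrow> A r \<in> sets borel" and B: "B \<in> sets borel"
  shows "prob ({\<omega> \<in> space M. \<forall>r\<in>T. W r \<omega> \<in> A r} \<inter> ((\<lambda>\<omega>. W t \<omega> - W s \<omega>) -` B \<inter> space M)) =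
    prob {\<omega> \<in> space M. \<forall>r\<in>T. W r \<omega> \<in> A r} * prob ((\<lambda>\<omega>. W t \<omega> - W s \<omega>) -` B \<inter> space M)"
proof -
  \<comment> \<open>Adding 0 lets the increments telescope from \<open>W 0 = 0\<close>; adding
    \<open>s\<close> makes the final increment of the extended list the one from \<open>s\<close> to
    \<open>t\<close>.\<close>
  define S where "S = insert 0 (insert s T)"
  define l where "l = sorted_list_of_set S"
  define n where "n = length l - 1"
  define ts where "ts = l @ [t]"
  define X where "X i \<omega> = W (ts ! Suc i) \<omega> - W (ts ! i) \<omega>" for i \<omega>
  have S: "finite S" "0 \<in> S" "s \<in> S" "S \<subseteq> {0..s}" using T st by (auto simp: S_def)
  have l: "set l = S" "sorted l" "distinct l" using S by (simp_all add: l_def)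
  have l_ne: "l \<noteq> []" using l(1) S(2) by auto
  then have len: "length l = Suc n" by (simp add: n_def)
  have l0: "l ! 0 = 0"
  proof -
    obtain i where i: "i < length l" "l ! i = 0" using l(1) S(2) by (metis in_set_conv_nth)
    have "l ! 0 \<le> 0" using sorted_nth_mono[OF l(2), of 0 i] i by simp
    moreover have "l ! 0 \<in> S" using l(1) len by (metis nth_mem zero_less_Suc)
    ultimately show ?thesis using S(4) by force
  qed
  have ln: "l ! n = s"
  proof -
    obtain i where i: "i < length l" "l ! i = s" using l(1) S(3) by (metis in_set_conv_nth)
    have "s \<le> l ! n" using sorted_nth_mono[OF l(2), of i n] i len by simp
    moreover have "l ! n \<in> S" using l(1) len by (metis nth_mem lessI)
    ultimately show ?thesis using S(4) by force
  qed
  have "sorted ts" "\<forall>t\<in>set ts. 0 \<le> t"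
    using l S(4) st by (force simp: ts_def sorted_append)+
  from W_indep_increments[OF this] have ind: "indep_vars (\<lambda>_. borel) X {..<Suc n}"
    unfolding X_def[abs_def] by (simp add: ts_def len)
  \<comment> \<open>Grouping preserves independence: the first \<open>n\<close> increments describe
    the past, and the one with index \<open>n\<close> is the future increment.\<close>
  have ind2: "indep_var (PiM {..<n} (\<lambda>_. borel)) (\<lambda>\<omega>. restrict (\<lambda>i. X i \<omega>) {..<n})
      (PiM {n} (\<lambda>_. borel)) (\<lambda>\<omega>. restrict (\<lambda>i. X i \<omega>) {n})"
    by (rule indep_var_restrict[OF ind]) auto
  have X_n: "X n \<omega> = W t \<omega> - W s \<omega>" for \<omega>
    using ln len by (simp add: X_def ts_def nth_append)
  have W_sum: "W (l ! k) \<omega> = (\<Sum>i<k. X i \<omega>)" if "k \<le> n" "\<omega> \<in> space M" for k \<omega>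
  proof -
    have "(\<Sum>i<k. X i \<omega>) = (\<Sum>i<k. W (l ! Suc i) \<omega> - W (l ! i) \<omega>)"
      using that len by (intro sum.cong) (auto simp: X_def ts_def nth_append)
    also have "\<dots> = W (l ! k) \<omega> - W (l ! 0) \<omega>" by (rule sum_lessThan_telescope)
    finally show ?thesis using l0 W_zero[OF that(2)] by simp
  qed
  \<comment> \<open>This is the cylinder event rewritten in increment coordinates, where the value
    at the time \<open>l ! k\<close> is the sum of the first \<open>k\<close> increments. The empty
    sum at \<open>k = 0\<close> stands for \<open>W 0 = 0\<close>.\<close>
  define C where "C = {g \<in> space (PiM {..<n} (\<lambda>_. borel :: real measure)).
      \<forall>k\<in>{k. k \<le> n \<and> l ! k \<in> T}. (\<Sum>i<k. g i) \<in> A (l ! k)}"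
  have C: "C \<in> sets (PiM {..<n} (\<lambda>_. borel))"
    unfolding C_def
  proof (intro sets.sets_Collect_finite_All)
    fix k assume k: "k \<in> {k. k \<le> n \<and> l ! k \<in> T}"
    have "(\<lambda>g. \<Sum>i<k. g i :: real) \<in> borel_measurable (PiM {..<n} (\<lambda>_. borel))"
      using k by (intro borel_measurable_sum measurable_component_singleton) auto
    moreover have "A (l ! k) \<in> sets borel" using A k by simp
    ultimately have "(\<lambda>g. \<Sum>i<k. g i) -` A (l ! k) \<inter> space (PiM {..<n} (\<lambda>_. borel)) \<in> sets (PiM {..<n} (\<lambda>_. borel))"
      by (rule measurable_sets)
    moreover have "(\<lambda>g. \<Sum>i<k. g i) -` A (l ! k) \<inter> space (PiM {..<n} (\<lambda>_. borel)) =
        {g \<in> space (PiM {..<n} (\<lambda>_. borel)). (\<Sum>i<k. g i) \<in> A (l ! k)}"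
      by auto
    ultimately show "{g \<in> space (PiM {..<n} (\<lambda>_. borel)). (\<Sum>i<k. g i) \<in> A (l ! k)} \<in> sets (PiM {..<n} (\<lambda>_. borel))"
      by simp
  qed auto
  define C' where "C' = (\<lambda>g. g n) -` B \<inter> space (PiM {n} (\<lambda>_. borel :: real measure))"
  have C': "C' \<in> sets (PiM {n} (\<lambda>_. borel))"
    unfolding C'_def by (rule measurable_sets[OF _ B], rule measurable_component_singleton) simp
  have T_l: "\<exists>k\<le>n. l ! k = r" if "r \<in> T" for r
  proof -
    have "r \<in> set l" using that l(1) by (simp add: S_def)
    then show ?thesis using len by (auto simp: in_set_conv_nth less_Suc_eq_le)
  qed
  have pre: "(\<lambda>\<omega>. restrict (\<lambda>i. X i \<omega>) {..<n}) -` C \<inter> space M = {\<omega> \<in> space M. \<forall>r\<in>T. W r \<omega> \<in> A r}"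
  proof -
    have "restrict (\<lambda>i. X i \<omega>) {..<n} \<in> C \<longleftrightarrow> (\<forall>r\<in>T. W r \<omega> \<in> A r)" if \<omega>: "\<omega> \<in> space M" for \<omega>
    proof -
      have "(\<Sum>i<k. restrict (\<lambda>i. X i \<omega>) {..<n} i) = W (l ! k) \<omega>" if "k \<le> n" for k
        unfolding W_sum[OF that \<omega>] using that by (intro sum.cong) auto
      then have "restrict (\<lambda>i. X i \<omega>) {..<n} \<in> C \<longleftrightarrow> (\<forall>k\<le>n. l ! k \<in> T \<longrightarrow> W (l ! k) \<omega> \<in> A (l ! k))"
        by (auto simp: C_def space_PiM)
      also have "\<dots> \<longleftrightarrow> (\<forall>r\<in>T. W r \<omega> \<in> A r)" using T_l by blast
      finally show ?thesis .
    qed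
    then show ?thesis by auto
  qed
  have pre': "(\<lambda>\<omega>. restrict (\<lambda>i. X i \<omega>) {n}) -` C' \<inter> space M = (\<lambda>\<omega>. W t \<omega> - W s \<omega>) -` B \<inter> space M"
    by (auto simp: C'_def X_n space_PiM)
  have "(\<lambda>\<omega>. (restrict (\<lambda>i. X i \<omega>) {..<n}, restrict (\<lambda>i. X i \<omega>) {n})) -` (C \<times> C') \<inter> space M =
    ((\<lambda>\<omega>. restrict (\<lambda>i. X i \<omega>) {..<n}) -` C \<inter> space M) \<inter> ((\<lambda>\<omega>. restrict (\<lambda>i. X i \<omega>) {n}) -` C' \<inter> space M)"
    by auto
  then show ?thesis using indep_varD[OF ind2 C C'] unfolding pre pre' by simp
qed

text \<open>Finite-dimensional cylinders form an intersection-stable generator of the past, so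
  independence extends from them to the generated sigma-algebra, and thus to every variable
  measurable with respect to it.\<close>

lemma indep_past_increment:
  assumes st: "0 \<le> s" "s < t" and X: "X \<in> borel_measurable (natural_filtration M W s)"
  shows "indep_var borel X borel (\<lambda>\<omega>. W t \<omega> - W s \<omega>)"
proof -
  define D where "D \<omega> = W t \<omega> - W s \<omega>" for \<omega>
  define \<G> where "\<G> = {{\<omega> \<in> space M. \<forall>r\<in>T. W r \<omega> \<in> A r} | T A.
      finite T \<and> T \<subseteq> {0..s} \<and> (\<forall>r\<in>T. A r \<in> sets (borel :: real measure))}"
  define \<D> where "\<D> = {D -` B \<inter> space M | B. B \<in> sets borel}"
  have [measurable]: "D \<in> borel_measurable M"
    unfolding D_def using st by (intro borel_measurable_diff W_measurable) auto
  have G_stable: "Int_stable \<G>"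
  proof (rule Int_stableI)
    fix a b assume "a \<in> \<G>" "b \<in> \<G>"
    then obtain T A T' A' where
      a: "a = {\<omega> \<in> space M. \<forall>r\<in>T. W r \<omega> \<in> A r}" "finite T" "T \<subseteq> {0..s}" "\<forall>r\<in>T. A r \<in> sets borel" and
      b: "b = {\<omega> \<in> space M. \<forall>r\<in>T'. W r \<omega> \<in> A' r}" "finite T'" "T' \<subseteq> {0..s}" "\<forall>r\<in>T'. A' r \<in> sets borel"
      unfolding \<G>_def by blast
    \<comment> \<open>The constraint \<open>UNIV\<close> fills in missing times, so that two
      cylinders over different time sets can be intersected over their union.\<close>
    define A'' where "A'' r = (if r \<in> T then A r else UNIV) \<inter> (if r \<in> T' then A' r else UNIV)" for r
    have "a \<inter> b = {\<omega> \<in> space M. \<forall>r\<in>T \<union> T'. W r \<omega> \<in> A'' r}"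
      unfolding a(1) b(1) A''_def by auto
    moreover have "\<forall>r\<in>T \<union> T'. A'' r \<in> sets borel" using a b by (auto simp: A''_def)
    ultimately show "a \<inter> b \<in> \<G>" unfolding \<G>_def using a b
      by (intro CollectI exI[of _ "T \<union> T'"] exI[of _ A'']) auto
  qed
  have D_stable: "Int_stable \<D>"
  proof (rule Int_stableI)
    fix a b assume "a \<in> \<D>" "b \<in> \<D>"
    then obtain B B' where "a = D -` B \<inter> space M" "b = D -` B' \<inter> space M" "B \<in> sets borel" "B' \<in> sets borel"
      unfolding \<D>_def by blast
    then show "a \<inter> b \<in> \<D>" unfolding \<D>_def by (intro CollectI exI[of _ "B \<inter> B'"]) auto
  qed
  have "indep_set \<G> \<D>"
    unfolding indep_sets2_eq
  proof (intro conjI ballI)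
    show "\<G> \<subseteq> events"
    proof
      fix a assume "a \<in> \<G>"
      then obtain T A where a: "a = {\<omega> \<in> space M. \<forall>r\<in>T. W r \<omega> \<in> A r}" "finite T" "T \<subseteq> {0..s}"
          "\<forall>r\<in>T. A r \<in> sets borel"
        unfolding \<G>_def by blast
      show "a \<in> events" unfolding a(1)
      proof (intro sets.sets_Collect_finite_All a(2))
        fix r assume "r \<in> T"
        then have "W r -` A r \<inter> space M \<in> events"
          using a by (intro measurable_sets[OF W_measurable]) auto
        then show "{\<omega> \<in> space M. W r \<omega> \<in> A r} \<in> events"
          by (simp add: vimage_def Int_def conj_commute)
      qed
    qed
    show "\<D> \<subseteq> events" unfolding \<D>_def by (auto intro: measurable_sets)
    fix a b assume "a \<in> \<G>" "b \<in> \<D>"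
    then show "prob (a \<inter> b) = prob a * prob b"
      unfolding \<G>_def \<D>_def D_def using indep_cylinder_increment[OF st] by blast
  qed
  then have ind: "indep_set (sigma_sets (space M) \<G>) (sigma_sets (space M) \<D>)"
    by (rule indep_set_sigma_sets[OF _ G_stable D_stable])
  have F_sub: "sets (natural_filtration M W s) \<subseteq> sigma_sets (space M) \<G>"
    unfolding sets_natural_filtration
  proof (rule sigma_sets_mono, rule subsetI)
    fix a assume "a \<in> (\<Union>r\<in>{0..s}. {W r -` A \<inter> space M | A. A \<in> sets borel})"
    then obtain r A where "r \<in> {0..s}" "A \<in> sets borel" "a = W r -` A \<inter> space M" by blast
    then have "a \<in> \<G>" unfolding \<G>_def
      by (intro CollectI exI[of _ "{r}"] exI[of _ "\<lambda>_. A"]) auto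
    then show "a \<in> sigma_sets (space M) \<G>" by blast
  qed
  have X_sub: "sigma_sets (space M) {X -` A \<inter> space M | A. A \<in> sets borel} \<subseteq> sigma_sets (space M) \<G>"
  proof (rule sigma_sets_mono, rule subsetI)
    fix a assume "a \<in> {X -` A \<inter> space M | A. A \<in> sets borel}"
    then show "a \<in> sigma_sets (space M) \<G>"
      using measurable_sets[OF X] F_sub by auto
  qed
  have "X \<in> borel_measurable M"
    using measurable_from_subalg[OF subalgebra_natural_filtration X] .
  moreover have "indep_set (sigma_sets (space M) {X -` A \<inter> space M | A. A \<in> sets borel})
      (sigma_sets (space M) {D -` A \<inter> space M | A. A \<in> sets borel})"
    using ind X_sub unfolding indep_sets2_eq \<D>_def by (meson subset_eq)
  ultimately show ?thesis unfolding indep_var_eq D_def[abs_def] using \<open>D \<in> borel_measurable M\<close>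
    by (simp add: D_def[abs_def])
qed

end

section \<open>Normal variables and transfer of the martingale property\<close>

lemma normal_distributed_moments:
  assumes X: "distributed M lborel X (normal_density 0 \<sigma>)" and \<sigma>: "\<sigma> > 0"
  shows "integrable M X" "(\<integral>\<omega>. X \<omega> \<partial>M) = 0"
    "integrable M (\<lambda>\<omega>. (X \<omega>)\<^sup>2)" "(\<integral>\<omega>. (X \<omega>)\<^sup>2 \<partial>M) = \<sigma>\<^sup>2"
proof -
  have i: "integrable lborel (\<lambda>x. normal_density 0 \<sigma> x * x)"
    "integrable lborel (\<lambda>x. normal_density 0 \<sigma> x * x\<^sup>2)"
    using integrable_normal_moment[OF \<sigma>, of 0 1] integrable_normal_moment[OF \<sigma>, of 0 2] by simp_all
  show "integrable M X" using distributed_integrable[OF X, of "\<lambda>x. x"] i(1) by simp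
  show "integrable M (\<lambda>\<omega>. (X \<omega>)\<^sup>2)" using distributed_integrable[OF X, of "\<lambda>x. x\<^sup>2"] i(2) by simp
  show "(\<integral>\<omega>. X \<omega> \<partial>M) = 0"
    using distributed_integral[OF X, of "\<lambda>x. x"] integral_normal_moment_odd[OF \<sigma>, of 0 0] by simp
  show "(\<integral>\<omega>. (X \<omega>)\<^sup>2 \<partial>M) = \<sigma>\<^sup>2"
    using distributed_integral[OF X, of "\<lambda>x. x\<^sup>2"] integral_normal_moment_even[OF \<sigma>, of 0 1] by simp
qed

text \<open>The density is positive everywhere, so an interval missed almost surely would be
  Lebesgue-null, contradicting its length 1.\<close>

lemma normal_distributed_interval_pos:
  assumes X: "distributed M lborel X (normal_density 0 \<sigma>)" and \<sigma>: "\<sigma> > 0" and "prob_space M"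
  shows "measure M (X -` {x<..<x + 1} \<inter> space M) > 0"
proof (rule ccontr)
  interpret prob_space M by fact
  let ?A = "{x<..<x + 1 :: real}"
  have [measurable]: "X \<in> borel_measurable M" using distributed_measurable[OF X] by simp
  assume "\<not> measure M (X -` ?A \<inter> space M) > 0"
  then have "prob (X -` ?A \<inter> space M) = 0" using measure_nonneg[of M] by (simp add: not_less order_antisym)
  then have "AE \<omega> in M. \<omega> \<notin> X -` ?A \<inter> space M"
    by (subst (asm) prob_eq_0) measurable
  then have "AE \<omega> in M. X \<omega> \<notin> ?A" by (rule AE_mp) (auto intro!: AE_I2)
  then have "AE y in lborel. 0 < ennreal (normal_density 0 \<sigma> y) \<longrightarrow> y \<notin> ?A"
    by (subst (asm) distributed_AE2[OF X]) measurable
  then have "AE y in lborel. y \<notin> ?A" using normal_density_pos[OF \<sigma>] by simp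
  then have "?A \<in> null_sets lborel" by (subst AE_iff_null_sets) auto
  then show False by (auto simp: null_sets_def)
qed

text \<open>Equality is asked for at nonnegative times only; this serves to replace the expectation
  of \<open>a * (W t)\<^sup>2\<close> by \<open>a * t\<close>, an identity known only there.\<close>

lemma martingale_cong:
  assumes eq: "\<And>t. t \<ge> 0 \<Longrightarrow> X t = Y t" and X: "martingale M F X"
  shows "martingale M F Y"
  unfolding martingale_def
proof (intro conjI allI impI)
  fix t :: real assume "t \<ge> 0"
  then show "integrable M (Y t)" "Y t \<in> borel_measurable (F t)"
    using X eq[of t] unfolding martingale_def by auto
next
  fix s t :: real assume st: "0 \<le> s" "s \<le> t"
  then have "AE \<omega> in M. real_cond_exp M (F s) (X t) \<omega> = X s \<omega>"
    using X unfolding martingale_def by blast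
  then show "AE \<omega> in M. real_cond_exp M (F s) (Y t) \<omega> = Y s \<omega>"
    using st by (simp only: eq order_trans[OF st])
qed

section \<open>The squared Brownian motion as a martingale\<close>

context brownian_motion
begin

lemma W_moments:
  assumes "t \<ge> 0"
  shows "integrable M (W t)" "integrable M (\<lambda>\<omega>. (W t \<omega>)\<^sup>2)" "expectation (\<lambda>\<omega>. (W t \<omega>)\<^sup>2) = t"
proof -
  have "integrable M (W t) \<and> integrable M (\<lambda>\<omega>. (W t \<omega>)\<^sup>2) \<and> expectation (\<lambda>\<omega>. (W t \<omega>)\<^sup>2) = t"
  proof (cases "t = 0")
    case True
    have *: "integrable M (W 0) \<longleftrightarrow> integrable M (\<lambda>_. 0::real)"
      "integrable M (\<lambda>\<omega>. (W 0 \<omega>)\<^sup>2) \<longleftrightarrow> integrable M (\<lambda>_. 0::real)"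
      "expectation (\<lambda>\<omega>. (W 0 \<omega>)\<^sup>2) = expectation (\<lambda>_. 0)"
      by (intro Bochner_Integration.integrable_cong Bochner_Integration.integral_cong refl, simp add: W_zero)+
    show ?thesis unfolding True * by simp
  next
    case False
    with assms have "t > 0" by simp
    then show ?thesis using normal_distributed_moments[OF W_distributed] by simp
  qed
  then show "integrable M (W t)" "integrable M (\<lambda>\<omega>. (W t \<omega>)\<^sup>2)" "expectation (\<lambda>\<omega>. (W t \<omega>)\<^sup>2) = t"
    by auto
qed

text \<open>With \<open>W t = W s + D\<close>, the square splits into three terms. Integrated over a
  past event, the cross term vanishes by independence and \<open>E D = 0\<close>, and
  \<open>D\<^sup>2\<close> contributes \<open>t - s\<close> times the probability of the event,
  which is exactly the change of the compensator.\<close>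

lemma square_martingale:
  "martingale M (natural_filtration M W) (\<lambda>t \<omega>. a * (W t \<omega>)\<^sup>2 - a * t)"
  unfolding martingale_def
proof (intro conjI allI impI)
  fix t :: real assume t: "t \<ge> 0"
  show "integrable M (\<lambda>\<omega>. a * (W t \<omega>)\<^sup>2 - a * t)" using W_moments(2)[OF t] by simp
  show "(\<lambda>\<omega>. a * (W t \<omega>)\<^sup>2 - a * t) \<in> borel_measurable (natural_filtration M W t)"
    using W_natural_filtration[OF t order_refl] by measurable
next
  fix s t :: real assume s: "0 \<le> s" and st: "s \<le> t"
  interpret F: finite_measure_subalgebra M "natural_filtration M W s"
    by (rule finite_measure_subalgebra_natural_filtration)
  have t: "t \<ge> 0" using s st by simp
  have int: "integrable M (\<lambda>\<omega>. a * (W r \<omega>)\<^sup>2 - a * r)" if "r \<ge> 0" for r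
    using W_moments(2)[OF that] by simp
  have Ws: "W s \<in> borel_measurable (natural_filtration M W s)"
    using W_natural_filtration[OF s order_refl] .
  then have meas: "(\<lambda>\<omega>. a * (W s \<omega>)\<^sup>2 - a * s) \<in> borel_measurable (natural_filtration M W s)"
    by measurable
  show "AE \<omega> in M. real_cond_exp M (natural_filtration M W s) (\<lambda>\<omega>. a * (W t \<omega>)\<^sup>2 - a * t) \<omega> =
      a * (W s \<omega>)\<^sup>2 - a * s"
  proof (rule F.real_cond_exp_charact[OF _ int[OF t] int[OF s] meas])
    fix A assume A: "A \<in> sets (natural_filtration M W s)"
    show "(\<integral>\<omega>\<in>A. a * (W t \<omega>)\<^sup>2 - a * t \<partial>M) = (\<integral>\<omega>\<in>A. a * (W s \<omega>)\<^sup>2 - a * s \<partial>M)"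
    proof (cases "s = t")
      case False
      with st have lt: "s < t" by simp
      define D where "D \<omega> = W t \<omega> - W s \<omega>" for \<omega>
      define I where "I = (indicator A :: 'a \<Rightarrow> real)"
      have Aev: "A \<in> events" using A subalgebra_natural_filtration by (auto simp: subalgebra_def)
      have D: "integrable M D" "expectation D = 0" "integrable M (\<lambda>\<omega>. (D \<omega>)\<^sup>2)"
        "expectation (\<lambda>\<omega>. (D \<omega>)\<^sup>2) = t - s"
        using normal_distributed_moments[OF W_increment[OF s lt]] lt unfolding D_def by simp_all
      have I_meas: "I \<in> borel_measurable (natural_filtration M W s)" unfolding I_def using A by measurable
      \<comment> \<open>The indicator is merged with \<open>W s\<close> into a single
        past-measurable factor, so that two-variable independence suffices for the cross
        term.\<close>
      have ind1: "indep_var borel (\<lambda>\<omega>. I \<omega> * W s \<omega>) borel D"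
        unfolding D_def[abs_def] using I_meas Ws by (intro indep_past_increment[OF s lt]) measurable
      have "indep_var borel ((\<lambda>x. x) \<circ> I) borel ((\<lambda>x. x\<^sup>2) \<circ> D)"
        unfolding D_def[abs_def] by (intro indep_var_compose[OF indep_past_increment[OF s lt I_meas]]) measurable
      then have ind2: "indep_var borel I borel (\<lambda>\<omega>. (D \<omega>)\<^sup>2)" by (simp add: comp_def)
      have I_int: "integrable M I" unfolding I_def using Aev by (simp add: emeasure_eq_measure)
      have IX: "integrable M (\<lambda>\<omega>. I \<omega> * X \<omega>)" if "integrable M X" for X :: "'a \<Rightarrow> real"
        using integrable_mult_indicator[OF Aev that] by (simp add: I_def)
      note IW = IX[OF W_moments(1)[OF s]] and IWW = IX[OF W_moments(2)[OF s]]
      have cross: "integrable M (\<lambda>\<omega>. (I \<omega> * W s \<omega>) * D \<omega>)" "(\<integral>\<omega>. (I \<omega> * W s \<omega>) * D \<omega> \<partial>M) = 0"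
        using indep_var_integrable[OF ind1 IW D(1)] indep_var_lebesgue_integral[OF ind1 IW D(1)] D(2) by simp_all
      have sq: "integrable M (\<lambda>\<omega>. I \<omega> * (D \<omega>)\<^sup>2)" "(\<integral>\<omega>. I \<omega> * (D \<omega>)\<^sup>2 \<partial>M) = expectation I * (t - s)"
        using indep_var_integrable[OF ind2 I_int D(3)] indep_var_lebesgue_integral[OF ind2 I_int D(3)] D(4) by simp_all
      have "(\<integral>\<omega>\<in>A. a * (W t \<omega>)\<^sup>2 - a * t \<partial>M) = (\<integral>\<omega>. a * (I \<omega> * (W s \<omega>)\<^sup>2) +
          2 * a * ((I \<omega> * W s \<omega>) * D \<omega>) + a * (I \<omega> * (D \<omega>)\<^sup>2) - a * t * I \<omega> \<partial>M)"
        unfolding set_lebesgue_integral_def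
      proof (rule Bochner_Integration.integral_cong[OF refl])
        fix \<omega>
        have "W t \<omega> = W s \<omega> + D \<omega>" by (simp add: D_def)
        then show "indicat_real A \<omega> *\<^sub>R (a * (W t \<omega>)\<^sup>2 - a * t) = a * (I \<omega> * (W s \<omega>)\<^sup>2) +
          2 * a * ((I \<omega> * W s \<omega>) * D \<omega>) + a * (I \<omega> * (D \<omega>)\<^sup>2) - a * t * I \<omega>"
          by (simp add: I_def power2_eq_square algebra_simps)
      qed
      also have "\<dots> = a * (\<integral>\<omega>. I \<omega> * (W s \<omega>)\<^sup>2 \<partial>M) + a * (expectation I * (t - s)) - a * t * expectation I"
        using IWW cross sq I_int by simp
      also have "\<dots> = a * (\<integral>\<omega>. I \<omega> * (W s \<omega>)\<^sup>2 \<partial>M) - a * s * expectation I"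
        by (simp add: algebra_simps)
      also have "\<dots> = (\<integral>\<omega>. a * (I \<omega> * (W s \<omega>)\<^sup>2) - a * s * I \<omega> \<partial>M)"
        using IWW I_int by simp
      also have "\<dots> = (\<integral>\<omega>\<in>A. a * (W s \<omega>)\<^sup>2 - a * s \<partial>M)"
        unfolding set_lebesgue_integral_def I_def
        by (intro Bochner_Integration.integral_cong) (auto simp: algebra_simps)
      finally show ?thesis .
    qed simp
  qed
qed

section \<open>Martingales that are functions of Brownian motion\<close>

lemma gaussian_integrable_of_W:
  assumes f: "f \<in> borel_measurable borel"
    and int: "\<And>t. t \<ge> 0 \<Longrightarrow> integrable M (\<lambda>\<omega>. f (W t \<omega>))"
  shows "gaussian_integrable f"
  unfolding gaussian_integrable_def
proof (intro conjI allI impI f)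
  fix b :: real assume b: "b > 0"
  \<comment> \<open>This is the time at which the density of \<open>W t\<close> is proportional to
    the kernel with parameter \<open>b\<close>.\<close>
  define t where "t = 1 / (2 * b)"
  have t: "t > 0" using b by (simp add: t_def)
  have "integrable lborel (\<lambda>x. normal_density 0 (sqrt t) x * f x)"
    using distributed_integrable[OF W_distributed[OF t], of f] int[of t] f t by simp
  also have "(\<lambda>x. normal_density 0 (sqrt t) x * f x) = (\<lambda>x. sqrt (b / pi) * (f x * exp (- (b * x\<^sup>2))))"
    unfolding t_def normal_density_precision[OF b] by (simp add: mult_ac)
  finally have "integrable lborel (\<lambda>x. sqrt (b / pi) * (f x * exp (- (b * x\<^sup>2))))" .
  moreover have "sqrt (b / pi) \<noteq> 0" using b by simp
  ultimately show "integrable lborel (\<lambda>x. f x * exp (- (b * x\<^sup>2)))"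
    using integrable_mult_left_iff[of lborel "sqrt (b / pi)"] by blast
qed

text \<open>The martingale property between the times 1 and \<open>1 + h\<close>, tested only on
  events determined by \<open>W 1\<close>, says that the mean of \<open>f (x + D) - f x - c\<close>
  over the increment \<open>D\<close> vanishes for almost every \<open>x\<close> under the law of
  \<open>W 1\<close>. Starting at time 1 rather than 0 makes this law equivalent to Lebesgue
  measure.\<close>

lemma martingale_gaussian_mean:
  fixes f :: "real \<Rightarrow> real"
  assumes f: "f \<in> borel_measurable borel"
    and int: "\<And>t. t \<ge> 0 \<Longrightarrow> integrable M (\<lambda>\<omega>. f (W t \<omega>))"
    and mart: "martingale M (natural_filtration M W) (\<lambda>t \<omega>. f (W t \<omega>) - g t)"
    and b: "b > 0"
  shows "\<exists>c. AE x in lborel. gaussian_mean b f x = (\<integral>y. exp (- (b * y\<^sup>2)) \<partial>lborel) * f x + c"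
proof -
  define h where "h = 1 / (2 * b)"
  have h: "h > 0" using b by (simp add: h_def)
  define c where "c = g (1 + h) - g 1"
  define D where "D \<omega> = W (1 + h) \<omega> - W 1 \<omega>" for \<omega>
  define \<mu> where "\<mu> = distr M borel (W 1)"
  define \<nu> where "\<nu> = distr M borel D"
  define \<phi> where "\<phi> x y = f (x + y) - f x - c" for x y
  have [measurable]: "f \<in> borel_measurable borel" by (rule f)
  have W1 [measurable]: "W 1 \<in> borel_measurable M" by (rule W_measurable) simp
  have Wh [measurable]: "W (1 + h) \<in> borel_measurable M" using h by (intro W_measurable) simp
  have Dm [measurable]: "D \<in> borel_measurable M" unfolding D_def by measurable
  have \<phi>_meas [measurable]: "case_prod \<phi> \<in> borel_measurable (borel \<Otimes>\<^sub>M borel)"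
    unfolding \<phi>_def by measurable
  interpret \<mu>: prob_space \<mu> unfolding \<mu>_def by (rule prob_space_distr) measurable
  interpret \<nu>: prob_space \<nu> unfolding \<nu>_def by (rule prob_space_distr) measurable
  interpret P: pair_prob_space \<mu> \<nu> ..
  interpret F: finite_measure_subalgebra M "natural_filtration M W 1"
    by (rule finite_measure_subalgebra_natural_filtration)
  have "indep_var borel (W 1) borel D"
    unfolding D_def[abs_def] using h by (intro indep_past_increment W_natural_filtration) auto
  \<comment> \<open>Independence turns the joint law into a product measure, which makes Fubini
    available.\<close>
  then have joint: "\<mu> \<Otimes>\<^sub>M \<nu> = distr M (borel \<Otimes>\<^sub>M borel) (\<lambda>\<omega>. (W 1 \<omega>, D \<omega>))"
    unfolding indep_var_distribution_eq \<mu>_def \<nu>_def by simp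
  have \<phi>_W: "\<phi> (W 1 \<omega>) (D \<omega>) = (f (W (1 + h) \<omega>) - g (1 + h)) - (f (W 1 \<omega>) - g 1)" for \<omega>
    by (simp add: \<phi>_def D_def c_def)
  have Ni: "integrable M (\<lambda>\<omega>. f (W (1 + h) \<omega>) - g (1 + h))" "integrable M (\<lambda>\<omega>. f (W 1 \<omega>) - g 1)"
    using int[of "1 + h"] int[of 1] h by simp_all
  have \<phi>_int: "integrable M (\<lambda>\<omega>. \<phi> (W 1 \<omega>) (D \<omega>))"
    unfolding \<phi>_W using Ni by (rule Bochner_Integration.integrable_diff)
  have \<phi>_int_P: "integrable (\<mu> \<Otimes>\<^sub>M \<nu>) (case_prod \<phi>)"
    unfolding joint by (subst integrable_distr_eq) (use \<phi>_int in \<open>simp_all\<close>)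
  \<comment> \<open>\<open>K (W 1)\<close> is the conditional mean, given \<open>W 1\<close>, of the
    martingale increment from 1 to \<open>1 + h\<close>.\<close>
  define K where "K x = (\<integral>y. \<phi> x y \<partial>\<nu>)" for x
  have K_int: "integrable \<mu> K"
    unfolding K_def using P.integrable_fst'[OF \<phi>_int_P] by simp
  have K_zero: "(\<integral>x\<in>B. K x \<partial>\<mu>) = 0" if "B \<in> sets \<mu>" for B
  proof -
    have B [measurable]: "B \<in> sets borel" using that by (simp add: \<mu>_def)
    define A where "A = W 1 -` B \<inter> space M"
    have A: "A \<in> sets (natural_filtration M W 1)"
      unfolding A_def using measurable_sets[OF W_natural_filtration[of 1 1] B] by simp
    then have Aev: "A \<in> events" using subalgebra_natural_filtration by (auto simp: subalgebra_def)
    have ce: "AE \<omega> in M. real_cond_exp M (natural_filtration M W 1) (\<lambda>\<omega>. f (W (1 + h) \<omega>) - g (1 + h)) \<omega> =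
        f (W 1 \<omega>) - g 1"
      using mart[unfolded martingale_def, THEN conjunct2, rule_format, of 1 "1 + h"] h by simp
    have "(\<integral>\<omega>\<in>A. f (W (1 + h) \<omega>) - g (1 + h) \<partial>M) =
        (\<integral>\<omega>\<in>A. real_cond_exp M (natural_filtration M W 1) (\<lambda>\<omega>. f (W (1 + h) \<omega>) - g (1 + h)) \<omega> \<partial>M)"
      by (rule F.real_cond_exp_intA[OF Ni(1) A])
    also have "\<dots> = (\<integral>\<omega>\<in>A. f (W 1 \<omega>) - g 1 \<partial>M)"
    proof (rule set_lebesgue_integral_cong_AE)
      show "AE \<omega>\<in>A in M. real_cond_exp M (natural_filtration M W 1) (\<lambda>\<omega>. f (W (1 + h) \<omega>) - g (1 + h)) \<omega> =
          f (W 1 \<omega>) - g 1"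
        using ce by eventually_elim simp
    qed (use Aev in measurable)
    finally have eq: "(\<integral>\<omega>\<in>A. f (W (1 + h) \<omega>) - g (1 + h) \<partial>M) = (\<integral>\<omega>\<in>A. f (W 1 \<omega>) - g 1 \<partial>M)" .
    have set_int: "integrable M (\<lambda>\<omega>. indicat_real A \<omega> *\<^sub>R X \<omega>)" if "integrable M X" for X :: "'a \<Rightarrow> real"
      using that Aev by (rule integrable_mult_indicator[rotated])
    have "(\<integral>\<omega>. indicator A \<omega> * \<phi> (W 1 \<omega>) (D \<omega>) \<partial>M) = 0"
      using eq set_int[OF Ni(1)] set_int[OF Ni(2)]
      unfolding \<phi>_W set_lebesgue_integral_def by (simp add: right_diff_distrib)
    also have "(\<integral>\<omega>. indicator A \<omega> * \<phi> (W 1 \<omega>) (D \<omega>) \<partial>M) = (\<integral>\<omega>. indicator B (W 1 \<omega>) * \<phi> (W 1 \<omega>) (D \<omega>) \<partial>M)"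
      by (intro Bochner_Integration.integral_cong) (auto simp: A_def indicator_def)
    also have "\<dots> = (\<integral>z. indicator B (fst z) * case_prod \<phi> z \<partial>(\<mu> \<Otimes>\<^sub>M \<nu>))"
      unfolding joint by (subst integral_distr) simp_all
    also have "\<dots> = (\<integral>x. (\<integral>y. indicator B x * \<phi> x y \<partial>\<nu>) \<partial>\<mu>)"
    proof (subst P.integral_fst'[symmetric])
      have "(\<lambda>z. indicator (B \<times> UNIV) z *\<^sub>R case_prod \<phi> z) = (\<lambda>z. indicator B (fst z) * case_prod \<phi> z)"
        by (auto simp: fun_eq_iff indicator_def)
      moreover have "B \<times> UNIV \<in> sets (\<mu> \<Otimes>\<^sub>M \<nu>)" by (intro pair_measureI) (auto simp: \<mu>_def \<nu>_def)
      ultimately show "integrable (\<mu> \<Otimes>\<^sub>M \<nu>) (\<lambda>z. indicator B (fst z) * case_prod \<phi> z)"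
        using integrable_mult_indicator[OF _ \<phi>_int_P, of "B \<times> UNIV"] by simp
    qed simp
    finally show ?thesis by (simp add: set_lebesgue_integral_def K_def)
  qed
  have "AE x in \<mu>. K x = 0"
    by (rule density_unique_real[OF K_int]) (use K_zero in auto)
  then have "AE \<omega> in M. K (W 1 \<omega>) = 0"
    unfolding \<mu>_def by (rule AE_distrD[rotated]) measurable
  moreover have [measurable]: "K \<in> borel_measurable borel"
    using borel_measurable_integrable[OF K_int] by (simp add: \<mu>_def)
  \<comment> \<open>The normal density is positive everywhere, so null sets of the law of
    \<open>W 1\<close> are Lebesgue-null.\<close>
  ultimately have "AE x in lborel. 0 < ennreal (normal_density 0 (sqrt 1) x) \<longrightarrow> K x = 0"
    by (subst (asm) distributed_AE2[OF W_distributed]) simp_all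
  then have K_AE: "AE x in lborel. K x = 0" by (simp add: normal_density_pos)
  have gi: "gaussian_integrable f" by (rule gaussian_integrable_of_W[OF f int])
  define Z where "Z = (\<integral>y. exp (- (b * y\<^sup>2)) \<partial>lborel)"
  have Z: "Z * sqrt (b / pi) = 1" unfolding Z_def by (rule gaussian_integral(1)[OF b])
  \<comment> \<open>The probability mean is \<open>sqrt (b / pi)\<close> times the unnormalized one;
    multiplication by \<open>Z\<close> later undoes this factor and turns the constant into
    \<open>Z * c\<close>.\<close>
  have K_eq: "K x = sqrt (b / pi) * gaussian_mean b f x - f x - c" for x
  proof -
    have dD: "distributed M lborel D (normal_density 0 (sqrt h))"
      unfolding D_def[abs_def] using W_increment[of 1 "1 + h"] h by simp
    have nd: "normal_density 0 (sqrt h) y = sqrt (b / pi) * exp (- (b * y\<^sup>2))" for y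
      unfolding h_def by (rule normal_density_precision[OF b])
    have i1: "integrable lborel (\<lambda>y. normal_density 0 (sqrt h) y * f (x + y))"
      using gaussian_integrableD[OF gaussian_integrable_shift[OF gi, of x] b]
      by (simp add: nd mult_ac)
    have "K x = (\<integral>\<omega>. \<phi> x (D \<omega>) \<partial>M)" unfolding K_def \<nu>_def by (rule integral_distr) measurable
    also have "\<dots> = (\<integral>y. normal_density 0 (sqrt h) y * \<phi> x y \<partial>lborel)"
      by (rule distributed_integral[OF dD, symmetric]) simp_all
    also have "\<dots> = (\<integral>y. normal_density 0 (sqrt h) y * f (x + y) - (f x + c) * normal_density 0 (sqrt h) y \<partial>lborel)"
      by (simp add: \<phi>_def algebra_simps)
    also have "\<dots> = (\<integral>y. normal_density 0 (sqrt h) y * f (x + y) \<partial>lborel) - (f x + c)"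
      using i1 h by simp
    also have "(\<integral>y. normal_density 0 (sqrt h) y * f (x + y) \<partial>lborel) = sqrt (b / pi) * gaussian_mean b f x"
      unfolding gaussian_mean_def nd by (simp add: mult_ac)
    finally show ?thesis by simp
  qed
  have "gaussian_mean b f x = Z * f x + Z * c" if "K x = 0" for x
  proof -
    have "Z * (sqrt (b / pi) * gaussian_mean b f x) = Z * (f x + c)"
      using that K_eq[of x] by simp
    then show ?thesis using Z by (simp add: algebra_simps mult.assoc[symmetric])
  qed
  with K_AE have "AE x in lborel. gaussian_mean b f x = Z * f x + Z * c" by auto
  then show ?thesis unfolding Z_def by blast
qed

text \<open>With positive probability \<open>W 1\<close> lies in \<open>(x, x + 1)\<close> and the
  next unit increment in \<open>(-2, -1)\<close>, which puts \<open>W 2\<close> below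
  \<open>x\<close>. Such an event meets the almost sure one, and the intermediate value theorem
  gives a crossing in \<open>[1, 2]\<close>. The crossing time depends on the path.\<close>

lemma path_visits:
  assumes P: "AE \<omega> in M. P \<omega>"
  obtains \<omega> t where "\<omega> \<in> space M" "P \<omega>" "t > 0" "W t \<omega> = x"
proof -
  define D where "D \<omega> = W 2 \<omega> - W 1 \<omega>" for \<omega>
  define E where "E = (W 1 -` {x<..<x+1} \<inter> space M) \<inter> (D -` {-2<..<-1} \<inter> space M)"
  have dD: "distributed M lborel D (normal_density 0 (sqrt 1))"
    unfolding D_def[abs_def] using W_increment[of 1 2] by simp
  have [measurable]: "W 1 \<in> borel_measurable M" "D \<in> borel_measurable M"
    using W_measurable[of 1] distributed_measurable[OF dD] by simp_all
  have "indep_var borel (W 1) borel D"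
    unfolding D_def[abs_def] by (intro indep_past_increment W_natural_filtration) auto
  from indep_varD[OF this, of "{x<..<x+1}" "{-2<..<-1}"]
  have "prob E = prob (W 1 -` {x<..<x+1} \<inter> space M) * prob (D -` {-2<..<-1} \<inter> space M)"
    by (simp add: E_def vimage_def Int_def conj_commute conj_left_commute)
  moreover have "prob (W 1 -` {x<..<x+1} \<inter> space M) > 0"
    by (rule normal_distributed_interval_pos[OF W_distributed]) (simp_all add: prob_space_axioms)
  moreover have "prob (D -` {-2<..<-1} \<inter> space M) > 0"
    using normal_distributed_interval_pos[OF dD _ prob_space_axioms, of "-2"] by simp
  ultimately have pos: "prob E > 0" by simp
  have "E \<in> events" unfolding E_def by measurable
  have "\<exists>\<omega>\<in>E. P \<omega>"
  proof (rule ccontr)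
    assume "\<not> (\<exists>\<omega>\<in>E. P \<omega>)"
    with P have "AE \<omega> in M. \<omega> \<notin> E" by auto
    then show False using pos prob_eq_0[OF \<open>E \<in> events\<close>] by simp
  qed
  then obtain \<omega> where \<omega>: "\<omega> \<in> E" "P \<omega>" by blast
  then have sp: "\<omega> \<in> space M" and up: "x \<le> W 1 \<omega>" and down: "W 2 \<omega> \<le> x"
    by (auto simp: E_def D_def)
  have "continuous_on {1..2} (\<lambda>t. W t \<omega>)" by (rule continuous_on_subset[OF W_continuous[OF sp]]) auto
  then obtain t where "1 \<le> t" "t \<le> 2" "W t \<omega> = x"
    using IVT2'[of "\<lambda>t. W t \<omega>" 2 x 1, OF down up] by auto
  then show ?thesis using that[of \<omega> t] sp \<omega>(2) by simp
qed

text \<open>A fixed \<open>x\<close> could lie in the exceptional null set. A path that is good at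
  all positive rational times is chosen to pass through \<open>x\<close>; right-continuity of the
  centered process, together with path continuity, carries the formula from rational times to the
  visiting time.\<close>

lemma right_continuous_AE_quadratic:
  fixes f :: "real \<Rightarrow> real"
  assumes f: "f \<in> borel_measurable borel"
    and rc: "right_continuous_process M (\<lambda>t \<omega>. f (W t \<omega>) - expectation (\<lambda>\<omega>'. f (W t \<omega>')))"
    and ae: "AE x in lborel. f x = a * x\<^sup>2 + k"
  shows "f x = a * x\<^sup>2 + k"
proof -
  define g where "g t = expectation (\<lambda>\<omega>'. f (W t \<omega>'))" for t
  have [measurable]: "f \<in> borel_measurable borel" by (rule f)
  have W_AE: "AE \<omega> in M. f (W s \<omega>) = a * (W s \<omega>)\<^sup>2 + k" if s: "s > 0" for s
    using ae by (subst distributed_AE2[OF W_distributed[OF s]]) auto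
  have g_eq: "g s = a * s + k" if s: "s > 0" for s
  proof -
    have [measurable]: "W s \<in> borel_measurable M" using s by (intro W_measurable) simp
    have "g s = (\<integral>\<omega>. a * (W s \<omega>)\<^sup>2 + k \<partial>M)"
      unfolding g_def by (rule integral_cong_AE[OF _ _ W_AE[OF s]]) measurable
    also have "\<dots> = a * s + k" using W_moments[of s] s by (simp add: prob_space)
    finally show ?thesis .
  qed
  \<comment> \<open>Countability of the rationals allows one almost sure event for all these times.
    Time 0 is left out because \<open>W 0\<close> has no density.\<close>
  have "AE \<omega> in M. \<forall>s\<in>{s\<in>\<rat>. s > 0}. f (W s \<omega>) = a * (W s \<omega>)\<^sup>2 + k"
    by (subst AE_ball_countable) (auto intro: W_AE countable_subset[OF _ countable_rat])
  then obtain \<omega> t where \<omega>: "\<omega> \<in> space M" and rat: "\<And>s. s \<in> \<rat> \<Longrightarrow> s > 0 \<Longrightarrow> f (W s \<omega>) = a * (W s \<omega>)\<^sup>2 + k"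
    and t: "t > 0" and x: "W t \<omega> = x"
    by (rule path_visits[where x = x]) auto
  \<comment> \<open>The rational times stay strictly above \<open>t\<close>, as convergence along
    \<open>at_right t\<close> demands.\<close>
  have "\<exists>s\<in>\<rat>. t < s \<and> s < t + 1 / real (Suc n)" for n by (rule Rats_dense_in_real) simp
  then obtain s where s: "\<And>n. s n \<in> \<rat>" "\<And>n. t < s n" "\<And>n. s n < t + 1 / real (Suc n)"
    by metis
  have s_lim: "s \<longlonglongrightarrow> t"
  proof (rule tendsto_sandwich[where f = "\<lambda>_. t" and h = "\<lambda>n. t + 1 / real (Suc n)"])
    show "(\<lambda>n. t + 1 / real (Suc n)) \<longlonglongrightarrow> t"
      using tendsto_add[OF tendsto_const[of t] LIMSEQ_inverse_real_of_nat] by (simp add: inverse_eq_divide)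
  qed (use s in \<open>auto intro!: always_eventually less_imp_le\<close>)
  have s_filter: "filterlim s (at_right t) sequentially"
    unfolding filterlim_at using s_lim s(2) by (auto intro!: always_eventually)
  have "((\<lambda>s. f (W s \<omega>) - g s) \<longlongrightarrow> f (W t \<omega>) - g t) (at_right t)"
    using rc \<omega> t unfolding right_continuous_process_def continuous_within g_def by simp
  from filterlim_compose[OF this s_filter]
  have "(\<lambda>n. f (W (s n) \<omega>) - g (s n)) \<longlonglongrightarrow> f x - (a * t + k)"
    by (simp add: x g_eq t)
  moreover have "f (W (s n) \<omega>) - g (s n) = a * (W (s n) \<omega>)\<^sup>2 - a * s n" for n
  proof -
    have "s n > 0" using t s(2)[of n] by simp
    then show ?thesis using rat[OF s(1)] g_eq by simp
  qed
  ultimately have lim: "(\<lambda>n. a * (W (s n) \<omega>)\<^sup>2 - a * s n) \<longlonglongrightarrow> f x - (a * t + k)" by simp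
  have "isCont (\<lambda>t. W t \<omega>) t"
    using W_continuous[OF \<omega>] t by (intro continuous_on_interior[of "{0..}"]) auto
  then have "(\<lambda>n. W (s n) \<omega>) \<longlonglongrightarrow> x" using isCont_tendsto_compose[OF _ s_lim] x by blast
  then have "(\<lambda>n. a * (W (s n) \<omega>)\<^sup>2 - a * s n) \<longlonglongrightarrow> a * x\<^sup>2 - a * t"
    by (intro tendsto_intros s_lim)
  from LIMSEQ_unique[OF lim this] show ?thesis by simp
qed

end

section \<open>The three assertions, linked through the closed form
  \<open>a * x\<^sup>2\<close>\<close>

theorem theorem3:
  fixes M :: "'a measure" and W :: "real \<Rightarrow> 'a \<Rightarrow> real" and f :: "real \<Rightarrow> real"
  assumes "complete_measure M"
    and "standard_brownian_motion M W"
  shows "((f \<in> borel_measurable borel \<and>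
            (\<forall>x y. f (x + y) + f (x - y) = 2 * f x + 2 * f y))
          \<longleftrightarrow>
          (f \<in> borel_measurable borel \<and> (\<forall>x. f (- x) = f x) \<and> f 0 = 0 \<and>
           (\<forall>t\<ge>0. integrable M (\<lambda>\<omega>. f (W t \<omega>))) \<and>
           martingale M (natural_filtration M W)
             (\<lambda>t \<omega>. f (W t \<omega>) - prob_space.expectation M (\<lambda>\<omega>'. f (W t \<omega>'))) \<and>
           right_continuous_process M
             (\<lambda>t \<omega>. f (W t \<omega>) - prob_space.expectation M (\<lambda>\<omega>'. f (W t \<omega>')))))
       \<and>
       ((f \<in> borel_measurable borel \<and> (\<forall>x. f (- x) = f x) \<and> f 0 = 0 \<and>
           (\<forall>t\<ge>0. integrable M (\<lambda>\<omega>. f (W t \<omega>))) \<and>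
           martingale M (natural_filtration M W)
             (\<lambda>t \<omega>. f (W t \<omega>) - prob_space.expectation M (\<lambda>\<omega>'. f (W t \<omega>'))) \<and>
           right_continuous_process M
             (\<lambda>t \<omega>. f (W t \<omega>) - prob_space.expectation M (\<lambda>\<omega>'. f (W t \<omega>'))))
        \<longleftrightarrow> (\<exists>a::real. \<forall>x. f x = a * x\<^sup>2))"
    (is "(?i \<longleftrightarrow> ?ii) \<and> (_ \<longleftrightarrow> ?iii)")
proof -
  interpret prob_space M using assms(2) unfolding standard_brownian_motion_def by blast
  interpret brownian_motion M W by unfold_locales (rule assms(2))
  have i_iii: ?iii if i: ?i
  proof -
    have "f x = f 1 * x\<^sup>2" for x using i by (intro quadratic_equation_measurable) auto
    then show ?thesis by blast
  qed
  have iii_i: ?i if ?iii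
  proof -
    from that obtain a where fa: "f = (\<lambda>x. a * x\<^sup>2)" by (auto simp: fun_eq_iff)
    show ?thesis unfolding fa by (auto simp: power2_eq_square algebra_simps)
  qed
  have iii_ii: ?ii if ?iii
  proof -
    from that obtain a where fa: "f = (\<lambda>x. a * x\<^sup>2)" by (auto simp: fun_eq_iff)
    have "martingale M (natural_filtration M W)
        (\<lambda>t \<omega>. a * (W t \<omega>)\<^sup>2 - expectation (\<lambda>\<omega>'. a * (W t \<omega>')\<^sup>2))"
      by (rule martingale_cong[OF _ square_martingale[of a]]) (simp add: W_moments(3))
    moreover have "right_continuous_process M
        (\<lambda>t \<omega>. a * (W t \<omega>)\<^sup>2 - expectation (\<lambda>\<omega>'. a * (W t \<omega>')\<^sup>2))"
      unfolding right_continuous_process_def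
    proof (intro ballI allI impI)
      fix \<omega> and t :: real assume \<omega>: "\<omega> \<in> space M" and t: "t \<ge> 0"
      have "continuous_on {0..} (\<lambda>s. a * (W s \<omega>)\<^sup>2 - a * s)"
        by (intro continuous_intros W_continuous[OF \<omega>])
      then have "continuous_on {0..} (\<lambda>s. a * (W s \<omega>)\<^sup>2 - expectation (\<lambda>\<omega>'. a * (W s \<omega>')\<^sup>2))"
        by (rule continuous_on_eq) (simp add: W_moments(3))
      \<comment> \<open>Path continuity is available only within the nonnegative half-line; for
        \<open>t \<ge> 0\<close> the times above \<open>t\<close> lie in it, so the right-hand limit
        is covered.\<close>
      then have "continuous (at t within {0..}) (\<lambda>s. a * (W s \<omega>)\<^sup>2 - expectation (\<lambda>\<omega>'. a * (W s \<omega>')\<^sup>2))"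
        using t by (simp add: continuous_on_eq_continuous_within)
      then show "continuous (at_right t) (\<lambda>s. a * (W s \<omega>)\<^sup>2 - expectation (\<lambda>\<omega>'. a * (W s \<omega>')\<^sup>2))"
        by (rule continuous_within_subset) (use t in auto)
    qed
    ultimately show ?thesis unfolding fa using W_moments(2) by simp
  qed
  have ii_iii: ?iii if ii: ?ii
  proof -
    have f: "f \<in> borel_measurable borel" and even: "\<And>x. f (- x) = f x" and f0: "f 0 = 0"
      and int: "\<And>t. t \<ge> 0 \<Longrightarrow> integrable M (\<lambda>\<omega>. f (W t \<omega>))"
      and mart: "martingale M (natural_filtration M W) (\<lambda>t \<omega>. f (W t \<omega>) - expectation (\<lambda>\<omega>'. f (W t \<omega>')))"
      and rc: "right_continuous_process M (\<lambda>t \<omega>. f (W t \<omega>) - expectation (\<lambda>\<omega>'. f (W t \<omega>')))"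
      using ii by auto
    obtain a k where "AE x in lborel. f x = a * x\<^sup>2 + k"
      using gaussian_mean_invariant_imp_quadratic[OF gaussian_integrable_of_W[OF f int] even
          martingale_gaussian_mean[OF f int mart]] by blast
    note eq = right_continuous_AE_quadratic[OF f rc this]
    have "k = 0" using eq[of 0] f0 by simp
    then show ?thesis using eq by auto
  qed
  show ?thesis using i_iii iii_i iii_ii ii_iii by argo
qed

end
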